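(* Let $E$ be a countable Borel equivalence relation on a standard Borel space $X$ and $\mathfrak{w}:E\to\mathbb{R}^+$ a Borel cocycle. For any $p \in \mathbb{R}^+$ and any Borel $\mathcal{S} \subseteq [X]_E^{<\infty}$, there are a Borel tiling $\mathcal{P} \subseteq \mathcal{S}$ and an $E$-invariant $\mathfrak{w}$-deficient Borel set $D\subseteq X$ such that, on $X\setminus D$ (i.e. for $\mathcal{P}|_{X\setminus D}$ and $\mathcal{S}|_{X\setminus D}$), $\mathcal{P}$ is $p$-packed within $\mathcal{S}$.
   Context: Cocycle: $\mathfrak{w}:E\to\mathbb{R}^+=(0,\infty)$, $(x,y)\mapsto\mathfrak{w}_x(y)$, with $\mathfrak{w}_x(y)\mathfrak{w}_y(z)=\mathfrak{w}_x(z)$ for $E$-related $x,y,z$. For $A$ contained in one $E$-class, $\mathfrak{w}_x(A):=\sum_{y\in A}\mathfrak{w}_x(y)$; the base point $x$ (any point of that class) is omitted in inequalities that do not depend on it. $[X]_E^{<\infty}$ is the standard Borel space of finite nonempty sets contained in a single $E$-class. A tiling is a collection $\mathcal{P}$ of pairwise disjoint sets; $\mathrm{dom}(\mathcal{P}):=\bigcup\mathcal{P}$; $E(\mathcal{P})$ is the equivalence relation whose classes are the sets in $\mathcal{P}$ and the singletons outside $\mathrm{dom}(\mathcal{P})$. $\mathcal{S}|_Y:=\{U\in\mathcal{S}:U\subseteq Y\}$. A set $A\in[X]_E^{<\infty}$ is a $p$-pack over a tiling $\mathcal{P}$ if $A$ is $E(\mathcal{P})$-invariant and $\mathfrak{w}(A\setminus\mathrm{dom}(\mathcal{P}))\ge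 p\cdot\mathfrak{w}(A\cap\mathrm{dom}(\mathcal{P}))$. A tiling $\mathcal{P}$ is $p$-packed within $\mathcal{S}$ if no set in $\mathcal{S}$ is a $p$-pack over $\mathcal{P}$. Deficiency: A transport is a function $\varphi:E\to[0,\infty)$; put $\mathrm{out}\,\varphi(x):=\sum_{y\in[x]_E}\varphi(x,y)$ and $\mathrm{in}\,\varphi(x):=\sum_{y\in[x]_E}\varphi(y,x)\mathfrak{w}_x(y)$. It is $\mathfrak{w}$-bounded if both functions are bounded by $1$. A point $x$ is a source (resp. sink) of $\varphi$ if $\mathrm{out}\,\varphi(x)-\mathrm{in}\,\varphi(x)$ is positive (resp. negative). $\varphi$ disbalances an $E$-class if the class contains at least one source and no sink, or at least one sink and no source. A set $Y\subseteq X$ is $\mathfrak{w}$-deficient if there is a $\mathfrak{w}$-bounded Borel transport disbalancing every $E$-class contained in $[Y]_E$. *)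

theory Defs
  imports "HOL-Analysis.Analysis"
begin

text \<open>The carrier of a measurable space \<open>M\<close> is \<open>X = space M\<close> and its Borel sets are \<open>sets M\<close>;
  the measure component of \<open>M\<close> is irrelevant.\<close>

definition standard_borel :: "'a measure \<Rightarrow> bool" where
  "standard_borel M \<longleftrightarrow>
     (\<exists>T. completely_metrizable_space T \<and> second_countable T \<and> topspace T = space M \<and>
          sets M = sigma_sets (space M) {U. openin T U})"

definition countable_borel_equiv :: "'a measure \<Rightarrow> ('a \<times> 'a) set \<Rightarrow> bool" where
  "countable_borel_equiv M E \<longleftrightarrow>
     equiv (space M) E \<and> E \<in> sets (M \<Otimes>\<^sub>M M) \<and> (\<forall>x\<in>space M. countable (E `` {x}))"

text \<open>Functions on \<open>E\<close> are curried and total; only their values on \<open>E\<close> matter. For a cocycle,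
  \<open>w x y\<close> is the value with base point \<open>x\<close> in the subscript, \<open>\<ww>\<^sub>x(y)\<close>.\<close>

definition borel_on_rel :: "'a measure \<Rightarrow> ('a \<times> 'a) set \<Rightarrow> ('a \<Rightarrow> 'a \<Rightarrow> real) \<Rightarrow> bool" where
  "borel_on_rel M E f \<longleftrightarrow>
     (\<lambda>(x, y). f x y) \<in> borel_measurable (restrict_space (M \<Otimes>\<^sub>M M) E)"

definition borel_cocycle :: "'a measure \<Rightarrow> ('a \<times> 'a) set \<Rightarrow> ('a \<Rightarrow> 'a \<Rightarrow> real) \<Rightarrow> bool" where
  "borel_cocycle M E w \<longleftrightarrow>
     borel_on_rel M E w \<and>
     (\<forall>(x, y)\<in>E. 0 < w x y) \<and>
     (\<forall>x y z. (x, y) \<in> E \<longrightarrow> (y, z) \<in> E \<longrightarrow> w x y * w y z = w x z)"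

definition weight :: "('a \<Rightarrow> 'a \<Rightarrow> real) \<Rightarrow> 'a \<Rightarrow> 'a set \<Rightarrow> ennreal" where
  "weight w x A = (\<Sum>\<^sub>\<infinity>y\<in>A. ennreal (w x y))"

definition invariant_under :: "('a \<times> 'a) set \<Rightarrow> 'a set \<Rightarrow> bool" where
  "invariant_under R A \<longleftrightarrow> R `` A = A"

definition finite_class_subsets :: "'a measure \<Rightarrow> ('a \<times> 'a) set \<Rightarrow> 'a set set" where
  "finite_class_subsets M E =
     {A. finite A \<and> A \<noteq> {} \<and> (\<exists>x\<in>space M. A \<subseteq> E `` {x})}"

text \<open>The Borel structure of \<open>[X]\<^sub>E\<^bsup><\<infinity>\<^esup>\<close> is the quotient structure under the maps
  \<open>(x\<^sub>0, \<dots>, x\<^sub>n\<^sub>-\<^sub>1) \<mapsto> {x\<^sub>0, \<dots>, x\<^sub>n\<^sub>-\<^sub>1}\<close>: a family is Borel iff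
  all its preimages in the finite powers \<open>X\<^sup>n\<close> are.\<close>

definition borel_families :: "'a measure \<Rightarrow> ('a \<times> 'a) set \<Rightarrow> 'a set set set" where
  "borel_families M E =
     {S. S \<subseteq> finite_class_subsets M E \<and>
         (\<forall>n. {f \<in> {..<n::nat} \<rightarrow>\<^sub>E space M. f ` {..<n} \<in> S} \<in> sets (\<Pi>\<^sub>M i\<in>{..<n}. M))}"

definition finite_class_space :: "'a measure \<Rightarrow> ('a \<times> 'a) set \<Rightarrow> 'a set measure" where
  "finite_class_space M E = sigma (finite_class_subsets M E) (borel_families M E)"

lemma borel_families_sigma_algebra:
  assumes E: "countable_borel_equiv M E"
  shows "sigma_algebra (finite_class_subsets M E) (borel_families M E)"
proof -
  let ?F = "finite_class_subsets M E"
  let ?pre = "\<lambda>n S. {f \<in> {..<n::nat} \<rightarrow>\<^sub>E space M. f ` {..<n} \<in> S}"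
  have eq: "equiv (space M) E" and meas: "E \<in> sets (M \<Otimes>\<^sub>M M)"
    using E by (auto simp: countable_borel_equiv_def)
  have full: "?pre n ?F \<in> sets (\<Pi>\<^sub>M i\<in>{..<n}. M)" for n
  proof (cases "n = 0")
    case True
    then show ?thesis by (simp add: finite_class_subsets_def)
  next
    case False
    have "?pre n ?F =
        {f \<in> space (\<Pi>\<^sub>M i\<in>{..<n}. M). \<forall>i\<in>{..<n}. (f 0, f i) \<in> E}"
    proof (intro set_eqI iffI)
      fix f assume f: "f \<in> ?pre n ?F"
      then obtain x where x: "\<And>i. i < n \<Longrightarrow> (x, f i) \<in> E"
        by (auto simp: finite_class_subsets_def)
      have "(f 0, f i) \<in> E" if "i < n" for i
        using equivE[OF eq] x[OF that] x[of 0] False by (meson gr0I symD transD)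
      then show "f \<in> {f \<in> space (\<Pi>\<^sub>M i\<in>{..<n}. M). \<forall>i\<in>{..<n}. (f 0, f i) \<in> E}"
        using f by (simp add: space_PiM)
    next
      fix f assume f: "f \<in> {f \<in> space (\<Pi>\<^sub>M i\<in>{..<n}. M). \<forall>i\<in>{..<n}. (f 0, f i) \<in> E}"
      then have "f 0 \<in> space M" "f ` {..<n} \<subseteq> E `` {f 0}"
        using False by (auto simp: space_PiM)
      then show "f \<in> ?pre n ?F"
        using f False by (auto simp: space_PiM finite_class_subsets_def lessThan_empty_iff)
    qed
    moreover have "{f \<in> space (\<Pi>\<^sub>M i\<in>{..<n}. M). \<forall>i\<in>{..<n}. (f 0, f i) \<in> E}
        \<in> sets (\<Pi>\<^sub>M i\<in>{..<n}. M)"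
    proof (intro sets.sets_Collect_finite_All)
      fix i assume "i \<in> {..<n}"
      then have "(\<lambda>f. (f 0, f i)) \<in> (\<Pi>\<^sub>M i\<in>{..<n}. M) \<rightarrow>\<^sub>M M \<Otimes>\<^sub>M M"
        using False by (intro measurable_Pair measurable_component_singleton) auto
      from measurable_sets[OF this meas]
      show "{f \<in> space (\<Pi>\<^sub>M i\<in>{..<n}. M). (f 0, f i) \<in> E} \<in> sets (\<Pi>\<^sub>M i\<in>{..<n}. M)"
        by (simp add: vimage_def Int_def conj_commute)
    qed simp
    ultimately show ?thesis by simp
  qed
  show ?thesis
    unfolding sigma_algebra_iff2
  proof (intro conjI ballI allI impI)
    show "borel_families M E \<subseteq> Pow ?F" "{} \<in> borel_families M E"
      by (auto simp: borel_families_def)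
  next
    fix S assume S: "S \<in> borel_families M E"
    have "?pre n (?F - S) = ?pre n ?F - ?pre n S" for n by auto
    then show "?F - S \<in> borel_families M E"
      using S full by (auto simp: borel_families_def)
  next
    fix S :: "nat \<Rightarrow> 'a set set" assume S: "range S \<subseteq> borel_families M E"
    have "?pre n (\<Union>k. S k) = (\<Union>k. ?pre n (S k))" for n by auto
    moreover have "(\<Union>k. ?pre n (S k)) \<in> sets (\<Pi>\<^sub>M i\<in>{..<n}. M)" for n
      using S by (intro sets.countable_UN) (auto simp: borel_families_def)
    ultimately show "(\<Union>k. S k) \<in> borel_families M E"
      using S by (auto simp: borel_families_def)
  qed
qed

lemma sets_finite_class_space:
  assumes "countable_borel_equiv M E"
  shows "sets (finite_class_space M E) = borel_families M E"
  unfolding finite_class_space_def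
  by (rule sigma_algebra.sets_measure_of_eq[OF borel_families_sigma_algebra[OF assms]])

definition tiling :: "'a set set \<Rightarrow> bool" where
  "tiling P \<longleftrightarrow> disjoint P"

definition tiling_rel :: "'a measure \<Rightarrow> 'a set set \<Rightarrow> ('a \<times> 'a) set" where
  "tiling_rel M P = (\<Union>U\<in>P. U \<times> U) \<union> Id_on (space M - \<Union>P)"

definition family_restrict :: "'a set set \<Rightarrow> 'a set \<Rightarrow> 'a set set" where
  "family_restrict S Y = {U \<in> S. U \<subseteq> Y}"

text \<open>The weight inequality does not depend on the base point \<open>x\<close> in the class of \<open>A\<close>.\<close>

definition pack_over ::
    "'a measure \<Rightarrow> ('a \<times> 'a) set \<Rightarrow> ('a \<Rightarrow> 'a \<Rightarrow> real) \<Rightarrow> real \<Rightarrow> 'a set set \<Rightarrow> 'a set \<Rightarrow> bool" where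
  "pack_over M E w p P A \<longleftrightarrow>
     A \<in> finite_class_subsets M E \<and>
     invariant_under (tiling_rel M P) A \<and>
     (\<forall>x\<in>space M. A \<subseteq> E `` {x} \<longrightarrow> ennreal p * weight w x (A \<inter> \<Union>P) \<le> weight w x (A - \<Union>P))"

definition packed_within ::
    "'a measure \<Rightarrow> ('a \<times> 'a) set \<Rightarrow> ('a \<Rightarrow> 'a \<Rightarrow> real) \<Rightarrow> real \<Rightarrow> 'a set set \<Rightarrow> 'a set set \<Rightarrow> bool" where
  "packed_within M E w p P S \<longleftrightarrow> (\<forall>A\<in>S. \<not> pack_over M E w p P A)"

definition borel_transport :: "'a measure \<Rightarrow> ('a \<times> 'a) set \<Rightarrow> ('a \<Rightarrow> 'a \<Rightarrow> real) \<Rightarrow> bool" where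
  "borel_transport M E \<phi> \<longleftrightarrow> borel_on_rel M E \<phi> \<and> (\<forall>(x, y)\<in>E. 0 \<le> \<phi> x y)"

definition outflow :: "('a \<times> 'a) set \<Rightarrow> ('a \<Rightarrow> 'a \<Rightarrow> real) \<Rightarrow> 'a \<Rightarrow> ennreal" where
  "outflow E \<phi> x = (\<Sum>\<^sub>\<infinity>y\<in>E `` {x}. ennreal (\<phi> x y))"

definition inflow ::
    "('a \<times> 'a) set \<Rightarrow> ('a \<Rightarrow> 'a \<Rightarrow> real) \<Rightarrow> ('a \<Rightarrow> 'a \<Rightarrow> real) \<Rightarrow> 'a \<Rightarrow> ennreal" where
  "inflow E w \<phi> x = (\<Sum>\<^sub>\<infinity>y\<in>E `` {x}. ennreal (\<phi> y x * w x y))"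

definition bounded_transport ::
    "'a measure \<Rightarrow> ('a \<times> 'a) set \<Rightarrow> ('a \<Rightarrow> 'a \<Rightarrow> real) \<Rightarrow> ('a \<Rightarrow> 'a \<Rightarrow> real) \<Rightarrow> bool" where
  "bounded_transport M E w \<phi> \<longleftrightarrow> (\<forall>x\<in>space M. outflow E \<phi> x \<le> 1 \<and> inflow E w \<phi> x \<le> 1)"

text \<open>Sources and sinks compare outflow with inflow, since the difference \<open>out - in\<close> is truncated
  in type \<^typ>\<open>ennreal\<close>.\<close>

definition source ::
    "('a \<times> 'a) set \<Rightarrow> ('a \<Rightarrow> 'a \<Rightarrow> real) \<Rightarrow> ('a \<Rightarrow> 'a \<Rightarrow> real) \<Rightarrow> 'a \<Rightarrow> bool" where
  "source E w \<phi> x \<longleftrightarrow> inflow E w \<phi> x < outflow E \<phi> x"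

definition sink ::
    "('a \<times> 'a) set \<Rightarrow> ('a \<Rightarrow> 'a \<Rightarrow> real) \<Rightarrow> ('a \<Rightarrow> 'a \<Rightarrow> real) \<Rightarrow> 'a \<Rightarrow> bool" where
  "sink E w \<phi> x \<longleftrightarrow> outflow E \<phi> x < inflow E w \<phi> x"

definition disbalances ::
    "('a \<times> 'a) set \<Rightarrow> ('a \<Rightarrow> 'a \<Rightarrow> real) \<Rightarrow> ('a \<Rightarrow> 'a \<Rightarrow> real) \<Rightarrow> 'a set \<Rightarrow> bool" where
  "disbalances E w \<phi> C \<longleftrightarrow>
     ((\<exists>x\<in>C. source E w \<phi> x) \<and> \<not> (\<exists>x\<in>C. sink E w \<phi> x)) \<or>
     ((\<exists>x\<in>C. sink E w \<phi> x) \<and> \<not> (\<exists>x\<in>C. source E w \<phi> x))"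

definition deficient ::
    "'a measure \<Rightarrow> ('a \<times> 'a) set \<Rightarrow> ('a \<Rightarrow> 'a \<Rightarrow> real) \<Rightarrow> 'a set \<Rightarrow> bool" where
  "deficient M E w Y \<longleftrightarrow>
     Y \<subseteq> space M \<and>
     (\<exists>\<phi>. borel_transport M E \<phi> \<and> bounded_transport M E w \<phi> \<and>
          (\<forall>C \<in> space M // E. C \<subseteq> E `` Y \<longrightarrow> disbalances E w \<phi> C))"

end

theory Submission
  imports Defs "HOL-Library.Sublist"
begin

text \<open>Enumerate the sets of \<open>S\<close> by countably many colours, distinct sets of one colour being
  disjoint, and visit every colour infinitely often. At each visit all sets of that colour which are
  packs over the current tiling become tiles, swallowing the tiles they contain. Where every point
  changes its tile only finitely often, the limit tiling admits no further pack. A point changing its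
  tile infinitely often lies in infinitely many growing packs, in each of which the fresh points
  outweigh the old ones up to the factor \<open>p\<close>. So every such point can receive mass \<open>1\<close> in total
  while sending out at most \<open>1\<close>; the points of the first pack send nothing and are sinks, hence the
  saturation of these unstable points is deficient.

  Borelness of the sets involved rests on the Lusin-Novikov theorem. For it, suppose that countably
  many Borel graphs never cover \<open>E\<close>. Writing \<open>E\<close> as a continuous image of a closed set of sequences,
  one builds a splitting tree of cylinders, at each level of which the images share a first
  coordinate. All its branches then have the same first coordinate \<open>x\<close>, and a diagonal choice of a
  branch yields a point of \<open>E `` {x}\<close> missing from a given enumeration of that section.\<close>

section \<open>Analytic sets\<close>

text \<open>The maps that enumerate the classes give finite sets countably many names: relative to a
  point, a finite subset of its class is a list of indices. Conditions on tiles and packs thereby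
  become countable combinations of Borel conditions on points. The splitting tree grows inside a
  remainder of \<open>E\<close>, left over after countably many graphs are removed. Plain
  non-coverage would not let every cylinder split again and again. The remainder is therefore chosen
  minimal: if removing countably many graphs can destroy the common first coordinates of a finite
  set of cylinders, it has already done so. As there are only countably many finite sets of words,
  one remainder serves them all. Above surviving common coordinates no cylinder then reduces to a
  single graph, and this is what permits each split. In the transport the obstacle is small
  \<open>p\<close>: the fresh points of one pack are only guaranteed \<open>p\<close> times the
  weight of the old ones, too little to pay each old point a full unit. The payment is spread over
  the least number k of packs with 1 <= p * k. This overcharges nobody, since a point is fresh in
  one pack only.\<close>

definition cylinder :: "nat list \<Rightarrow> (nat \<Rightarrow> nat) set" where
  "cylinder s = {a. \<forall>i<length s. a i = s ! i}"

text \<open>Allowing any closed set of sequences as domain, including the empty one, lets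
  intersections and preimages be treated by shrinking the domain while the map keeps its
  formula.\<close>

definition analytic_in :: "'a topology \<Rightarrow> 'a set \<Rightarrow> bool" where
  "analytic_in T A \<longleftrightarrow> (\<exists>C f. closed (C :: (nat \<Rightarrow> nat) set) \<and> continuous_map (top_of_set C) T f \<and> A = f ` C)"

definition borel_in :: "'a topology \<Rightarrow> 'a set set" where
  "borel_in T = sigma_sets (topspace T) {U. openin T U}"

section \<open>Topology of Baire space through finite initial segments\<close>

lemma cylinder_Nil [simp]: "cylinder [] = UNIV"
  by (simp add: cylinder_def)

lemma in_cylinder_map [simp]: "a \<in> cylinder (map b [0..<n]) \<longleftrightarrow> (\<forall>i<n. a i = b i)"
  by (simp add: cylinder_def)

lemma cylinder_extensions: "cylinder s = (\<Union>k. cylinder (s @ [k]))"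
  by (auto simp: cylinder_def nth_append less_Suc_eq)

lemma open_cylinder: "open (cylinder s)"
proof -
  have "open ((\<lambda>a. a i) -` {s ! i} :: (nat \<Rightarrow> nat) set)" for i
    by (intro open_vimage) (auto simp: open_discrete)
  then have "open (\<Inter>i<length s. (\<lambda>a. a i) -` {s ! i} :: (nat \<Rightarrow> nat) set)"
    by (intro open_INT) auto
  also have "(\<Inter>i<length s. (\<lambda>a. a i) -` {s ! i}) = cylinder s"
    by (auto simp: cylinder_def)
  finally show ?thesis .
qed

lemma open_contains_cylinder:
  assumes "open W" "a \<in> W"
  shows "\<exists>n. cylinder (map a [0..<n]) \<subseteq> W"
proof -
  obtain X where X: "a \<in> (\<Pi>\<^sub>E i\<in>UNIV. X i)" "finite {i. X i \<noteq> UNIV}" "(\<Pi>\<^sub>E i\<in>UNIV. X i) \<subseteq> W"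
    using product_topology_open_contains_basis[OF assms(1)[unfolded open_fun_def] assms(2)]
    unfolding topspace_euclidean by blast
  obtain n where n: "\<And>i. X i \<noteq> UNIV \<Longrightarrow> i < n"
    using X(2) unfolding finite_nat_set_iff_bounded by blast
  have "cylinder (map a [0..<n]) \<subseteq> (\<Pi>\<^sub>E i\<in>UNIV. X i)"
  proof
    fix b assume b: "b \<in> cylinder (map a [0..<n])"
    have "b i \<in> X i" for i
    proof (cases "i < n")
      case True
      then have "b i = a i" using b by simp
      then show ?thesis using X(1) by (simp add: PiE_def Pi_def)
    qed (use n in blast)
    then show "b \<in> (\<Pi>\<^sub>E i\<in>UNIV. X i)" by auto
  qed
  then show ?thesis using X(3) by blast
qed

text \<open>Closed sets of sequences are the branch sets of trees, so closedness can be checked on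
  finitely many entries at a time.\<close>

lemma closed_seqI:
  assumes "\<And>a. (\<And>n. \<exists>b\<in>C. \<forall>i<n. b i = a i) \<Longrightarrow> a \<in> C"
  shows "closed (C :: (nat \<Rightarrow> nat) set)"
  unfolding closed_def
proof (subst open_subopen, intro ballI)
  fix a assume "a \<in> - C"
  then have "\<not> (\<forall>n. \<exists>b\<in>C. \<forall>i<n. b i = a i)" using assms[of a] by blast
  then obtain n where n: "\<not> (\<exists>b\<in>C. \<forall>i<n. b i = a i)" by blast
  have "cylinder (map a [0..<n]) \<subseteq> - C"
  proof
    fix b assume "b \<in> cylinder (map a [0..<n])"
    then have "\<forall>i<n. b i = a i" by simp
    then show "b \<in> - C" using n by blast
  qed
  then show "\<exists>T. open T \<and> a \<in> T \<and> T \<subseteq> - C"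
    using open_cylinder[of "map a [0..<n]"] by (intro exI[of _ "cylinder (map a [0..<n])"]) simp
qed

lemma closed_seqD:
  assumes "closed (C :: (nat \<Rightarrow> nat) set)" "\<And>n. \<exists>b\<in>C. \<forall>i<n. b i = a i"
  shows "a \<in> C"
proof (rule ccontr)
  assume "a \<notin> C"
  then obtain n where "cylinder (map a [0..<n]) \<subseteq> - C"
    using open_contains_cylinder[of "- C" a] assms(1) by (auto simp: closed_def)
  moreover obtain b where "b \<in> C" "\<forall>i<n. b i = a i" using assms(2) by blast
  moreover from this have "b \<in> cylinder (map a [0..<n])" by simp
  ultimately show False by blast
qed

lemma continuous_map_seqI:
  fixes C :: "(nat \<Rightarrow> nat) set"
  assumes "\<And>a. a \<in> C \<Longrightarrow> f a \<in> topspace T"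
    and "\<And>a U. a \<in> C \<Longrightarrow> openin T U \<Longrightarrow> f a \<in> U \<Longrightarrow> \<exists>n. \<forall>b\<in>C. (\<forall>i<n. b i = a i) \<longrightarrow> f b \<in> U"
  shows "continuous_map (top_of_set C) T f"
  unfolding continuous_map_def
proof (intro conjI allI impI)
  fix U assume U: "openin T U"
  show "openin (top_of_set C) {a \<in> topspace (top_of_set C). f a \<in> U}"
  proof (subst openin_subopen, intro ballI)
    fix a assume a: "a \<in> {a \<in> topspace (top_of_set C). f a \<in> U}"
    then have "a \<in> C" "f a \<in> U" by auto
    then obtain n where n: "\<forall>b\<in>C. (\<forall>i<n. b i = a i) \<longrightarrow> f b \<in> U"
      using assms(2) U by metis
    show "\<exists>W. openin (top_of_set C) W \<and> a \<in> W \<and> W \<subseteq> {a \<in> topspace (top_of_set C). f a \<in> U}"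
      using a n by (intro exI[of _ "C \<inter> cylinder (map a [0..<n])"])
        (auto simp: openin_open intro!: exI[of _ "cylinder (map a [0..<n])"] open_cylinder)
  qed
qed (use assms in auto)

lemma continuous_map_seqD:
  fixes C :: "(nat \<Rightarrow> nat) set"
  assumes "continuous_map (top_of_set C) T f" "a \<in> C" "openin T U" "f a \<in> U"
  shows "\<exists>n. \<forall>b\<in>C. (\<forall>i<n. b i = a i) \<longrightarrow> f b \<in> U"
proof -
  have "openin (top_of_set C) {a \<in> C. f a \<in> U}"
    using assms(1,3) by (auto simp: continuous_map_def)
  then obtain W where W: "open W" "{a \<in> C. f a \<in> U} = C \<inter> W" by (auto simp: openin_open)
  then obtain n where "cylinder (map a [0..<n]) \<subseteq> W"
    using open_contains_cylinder[of W a] assms by blast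
  then show ?thesis using W by (intro exI[of _ n]) (auto simp: subset_iff)
qed

section \<open>Closure properties of analytic sets\<close>

lemma analytic_inI:
  "closed (C :: (nat \<Rightarrow> nat) set) \<Longrightarrow> continuous_map (top_of_set C) T f \<Longrightarrow> analytic_in T (f ` C)"
  unfolding analytic_in_def by blast

lemma analytic_in_subset: "analytic_in T A \<Longrightarrow> A \<subseteq> topspace T"
  unfolding analytic_in_def using continuous_map_image_subset_topspace by fastforce

lemma analytic_in_empty [simp]: "analytic_in T {}"
  unfolding analytic_in_def by (intro exI[of _ "{}"]) (auto simp: continuous_map_def)

lemma analytic_in_image:
  assumes "analytic_in T A" "continuous_map T T' \<phi>"
  shows "analytic_in T' (\<phi> ` A)"
proof -
  obtain C f where "closed (C :: (nat \<Rightarrow> nat) set)" "continuous_map (top_of_set C) T f" "A = f ` C"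
    using assms(1) by (auto simp: analytic_in_def)
  then show ?thesis
    using analytic_inI[of C T' "\<phi> \<circ> f"] assms(2) continuous_map_compose by (fastforce simp: image_comp)
qed

text \<open>The first entry of a code selects the set, the remaining entries code a point of
  it.\<close>

lemma analytic_in_UN:
  assumes "\<And>n::nat. analytic_in T (A n)"
  shows "analytic_in T (\<Union>n. A n)"
proof -
  obtain C f where C: "\<And>n. closed (C n :: (nat \<Rightarrow> nat) set)"
      "\<And>n. continuous_map (top_of_set (C n)) T (f n)" "\<And>n. A n = f n ` C n"
    using assms unfolding analytic_in_def by metis
  define sh where "sh a = (\<lambda>k. a (Suc k))" for a :: "nat \<Rightarrow> nat"
  define D where "D = {a. sh a \<in> C (a 0)}"
  have "closed D"
  proof (rule closed_seqI)
    fix a assume a: "\<And>n. \<exists>b\<in>D. \<forall>i<n. b i = a i"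
    have "sh a \<in> C (a 0)"
    proof (rule closed_seqD[OF C(1)])
      fix n
      obtain b where "b \<in> D" "\<forall>i<Suc n. b i = a i" using a by blast
      then show "\<exists>b\<in>C (a 0). \<forall>i<n. b i = sh a i"
        by (intro bexI[of _ "sh b"]) (auto simp: D_def sh_def)
    qed
    then show "a \<in> D" by (simp add: D_def)
  qed
  moreover have "continuous_map (top_of_set D) T (\<lambda>a. f (a 0) (sh a))"
  proof (rule continuous_map_seqI)
    fix a assume "a \<in> D"
    then show "f (a 0) (sh a) \<in> topspace T"
      using C(2)[of "a 0"] by (auto simp: D_def continuous_map_def)
  next
    fix a U assume a: "a \<in> D" "openin T U" "f (a 0) (sh a) \<in> U"
    obtain n where n: "\<forall>b\<in>C (a 0). (\<forall>i<n. b i = sh a i) \<longrightarrow> f (a 0) b \<in> U"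
      using continuous_map_seqD[OF C(2)[of "a 0"], of "sh a" U] a unfolding D_def by blast
    show "\<exists>n. \<forall>b\<in>D. (\<forall>i<n. b i = a i) \<longrightarrow> f (b 0) (sh b) \<in> U"
    proof (intro exI[of _ "Suc n"] ballI impI)
      fix b assume "b \<in> D" "\<forall>i<Suc n. b i = a i"
      then show "f (b 0) (sh b) \<in> U" using n by (auto simp: D_def sh_def)
    qed
  qed
  moreover have "(\<lambda>a. f (a 0) (sh a)) ` D = (\<Union>n. A n)"
  proof (intro set_eqI iffI)
    fix x assume "x \<in> (\<Union>n. A n)"
    then obtain n b where "b \<in> C n" "x = f n b" using C(3) by auto
    then show "x \<in> (\<lambda>a. f (a 0) (sh a)) ` D"
      by (intro image_eqI[of _ _ "case_nat n b"]) (auto simp: D_def sh_def)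
  qed (auto simp: D_def C(3))
  ultimately show ?thesis using analytic_inI by metis
qed

text \<open>One sequence packs a code for each of the sets by means of \<open>prod_encode\<close>;
  the domain keeps those sequences whose components all code the same point.\<close>

lemma analytic_in_INT:
  assumes T: "Hausdorff_space T" and "\<And>n::nat. analytic_in T (A n)"
  shows "analytic_in T (\<Inter>n. A n)"
proof -
  obtain C f where C: "\<And>n. closed (C n :: (nat \<Rightarrow> nat) set)"
      "\<And>n. continuous_map (top_of_set (C n)) T (f n)" "\<And>n. A n = f n ` C n"
    using assms unfolding analytic_in_def by metis
  define pr where "pr n a = (\<lambda>k. a (prod_encode (n, k)))" for n and a :: "nat \<Rightarrow> nat"
  have pr: "\<exists>m. \<forall>a b. (\<forall>i<m. b i = a i) \<longrightarrow> (\<forall>i<k. pr n b i = pr n a i)" for n k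
  proof -
    have "finite ((\<lambda>i. prod_encode (n, i)) ` {..<k})" by simp
    then obtain m where "\<forall>i<k. prod_encode (n, i) < m"
      unfolding finite_nat_set_iff_bounded by auto
    then show ?thesis by (intro exI[of _ m]) (auto simp: pr_def)
  qed
  define D' where "D' = {a. \<forall>n. pr n a \<in> C n}"
  define D where "D = {a \<in> D'. \<forall>n. f n (pr n a) = f 0 (pr 0 a)}"
  have D': "closed D'"
  proof (rule closed_seqI)
    fix a assume a: "\<And>n. \<exists>b\<in>D'. \<forall>i<n. b i = a i"
    have "pr n a \<in> C n" for n
    proof (rule closed_seqD[OF C(1)])
      fix k
      obtain m where m: "\<forall>a b. (\<forall>i<m. b i = a i) \<longrightarrow> (\<forall>i<k. pr n b i = pr n a i)" using pr by blast
      obtain b where "b \<in> D'" "\<forall>i<m. b i = a i" using a by blast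
      then show "\<exists>b\<in>C n. \<forall>i<k. b i = pr n a i"
        using m by (intro bexI[of _ "pr n b"]) (auto simp: D'_def)
    qed
    then show "a \<in> D'" by (simp add: D'_def)
  qed
  have cont: "continuous_map (top_of_set D') T (\<lambda>a. f n (pr n a))" for n
  proof (rule continuous_map_seqI)
    fix a assume "a \<in> D'"
    then show "f n (pr n a) \<in> topspace T"
      using C(2)[of n] by (auto simp: D'_def continuous_map_def)
  next
    fix a U assume a: "a \<in> D'" "openin T U" "f n (pr n a) \<in> U"
    obtain k where k: "\<forall>b\<in>C n. (\<forall>i<k. b i = pr n a i) \<longrightarrow> f n b \<in> U"
      using continuous_map_seqD[OF C(2)[of n], of "pr n a" U] a unfolding D'_def by blast
    obtain m where m: "\<forall>a b. (\<forall>i<m. b i = a i) \<longrightarrow> (\<forall>i<k. pr n b i = pr n a i)" using pr by blast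
    show "\<exists>m. \<forall>b\<in>D'. (\<forall>i<m. b i = a i) \<longrightarrow> f n (pr n b) \<in> U"
      using k m unfolding D'_def by blast
  qed
  \<comment> \<open>Here Hausdorffness enters: two continuous maps into a Hausdorff space agree on a
    closed set.\<close>
  have "closedin (top_of_set D') {a \<in> D'. f n (pr n a) = f 0 (pr 0 a)}" for n
    using closedin_continuous_maps_eq[OF T cont[of n] cont[of 0]] by simp
  then have "closed {a \<in> D'. f n (pr n a) = f 0 (pr 0 a)}" for n
    using D' closedin_closed_eq by blast
  then have "closed (\<Inter>n. {a \<in> D'. f n (pr n a) = f 0 (pr 0 a)})" by blast
  also have "(\<Inter>n. {a \<in> D'. f n (pr n a) = f 0 (pr 0 a)}) = D" by (auto simp: D_def)
  finally have "closed D" .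
  moreover have "continuous_map (top_of_set D) T (\<lambda>a. f 0 (pr 0 a))"
    using continuous_map_from_subtopology_mono[OF cont[of 0], of D] by (auto simp: D_def)
  moreover have "(\<lambda>a. f 0 (pr 0 a)) ` D = (\<Inter>n. A n)"
  proof (intro set_eqI iffI)
    fix x assume "x \<in> (\<lambda>a. f 0 (pr 0 a)) ` D"
    then obtain a where a: "a \<in> D" "x = f 0 (pr 0 a)" by auto
    show "x \<in> (\<Inter>n. A n)"
    proof
      fix n
      have "f n (pr n a) = x" "pr n a \<in> C n"
        using a unfolding D_def D'_def by simp_all
      then show "x \<in> A n" unfolding C(3)[of n] by (metis imageI)
    qed
  next
    fix x assume "x \<in> (\<Inter>n. A n)"
    then have "\<forall>n. \<exists>b. b \<in> C n \<and> x = f n b" using C(3) by auto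
    then obtain b where b: "\<And>n. b n \<in> C n \<and> x = f n (b n)" by metis
    have "pr n (\<lambda>m. case prod_decode m of (n, k) \<Rightarrow> b n k) = b n" for n
      by (auto simp: pr_def)
    then show "x \<in> (\<lambda>a. f 0 (pr 0 a)) ` D"
      using b by (intro image_eqI[of _ _ "\<lambda>m. case prod_decode m of (n, k) \<Rightarrow> b n k"])
        (auto simp: D_def D'_def)
  qed
  ultimately show ?thesis using analytic_inI by metis
qed

lemma UN_nat_if: "(\<Union>n::nat. if n = 0 then A else B) = A \<union> B"
  by (auto split: if_splits)

lemma INT_nat_if: "(\<Inter>n::nat. if n = 0 then A else B) = A \<inter> B"
  by (auto split: if_splits)

lemma analytic_in_Un: "analytic_in T A \<Longrightarrow> analytic_in T B \<Longrightarrow> analytic_in T (A \<union> B)"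
  using analytic_in_UN[of T "\<lambda>n. if n = 0 then A else B"] unfolding UN_nat_if by presburger

lemma analytic_in_Int:
  "Hausdorff_space T \<Longrightarrow> analytic_in T A \<Longrightarrow> analytic_in T B \<Longrightarrow> analytic_in T (A \<inter> B)"
  using analytic_in_INT[of T "\<lambda>n. if n = 0 then A else B"] unfolding INT_nat_if by presburger

lemma analytic_in_finite_INT:
  assumes "Hausdorff_space T" "finite I" "I \<noteq> {}" "\<And>i. i \<in> I \<Longrightarrow> analytic_in T (A i)"
  shows "analytic_in T (\<Inter>i\<in>I. A i)"
  using assms(2-) by (induction I rule: finite_ne_induct) (auto intro: analytic_in_Int[OF assms(1)])

lemma analytic_in_countable_UN:
  assumes "countable I" "\<And>i. i \<in> I \<Longrightarrow> analytic_in T (A i)"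
  shows "analytic_in T (\<Union>i\<in>I. A i)"
proof (cases "I = {}")
  case False
  have "analytic_in T (\<Union>n. A (from_nat_into I n))"
    by (rule analytic_in_UN) (simp add: assms(2) from_nat_into[OF False])
  moreover have "(\<Union>n. A (from_nat_into I n)) = \<Union> (A ` range (from_nat_into I))"
    by (simp add: image_image)
  ultimately show ?thesis
    by (simp add: range_from_nat_into[OF False assms(1)])
qed simp

lemma analytic_in_cylinder_image:
  assumes "closed C" "continuous_map (top_of_set C) T f"
  shows "analytic_in T (f ` (C \<inter> cylinder s))"
proof (rule analytic_inI)
  have "closed (cylinder s)"
  proof (rule closed_seqI)
    fix a assume "\<And>n. \<exists>b\<in>cylinder s. \<forall>i<n. b i = a i"
    then obtain b where "b \<in> cylinder s" "\<forall>i<length s. b i = a i" by blast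
    then show "a \<in> cylinder s" by (auto simp: cylinder_def)
  qed
  then show "closed (C \<inter> cylinder s)" using assms(1) by blast
  show "continuous_map (top_of_set (C \<inter> cylinder s)) T f"
    using continuous_map_from_subtopology_mono[OF assms(2)] by simp
qed

lemma analytic_in_Times:
  assumes "analytic_in T A" "analytic_in T' B"
  shows "analytic_in (prod_topology T T') (A \<times> B)"
proof -
  obtain C f where C: "closed (C :: (nat \<Rightarrow> nat) set)" "continuous_map (top_of_set C) T f" "A = f ` C"
    using assms(1) by (auto simp: analytic_in_def)
  obtain D g where D: "closed (D :: (nat \<Rightarrow> nat) set)" "continuous_map (top_of_set D) T' g" "B = g ` D"
    using assms(2) by (auto simp: analytic_in_def)
  \<comment> \<open>A code of a pair interleaves the codes of its components.\<close>
  define ev where "ev a = (\<lambda>k. a (2 * k))" for a :: "nat \<Rightarrow> nat"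
  define od where "od a = (\<lambda>k. a (Suc (2 * k)))" for a :: "nat \<Rightarrow> nat"
  have ev: "continuous_on X ev" and od: "continuous_on X od" for X
    unfolding ev_def od_def
    by (intro continuous_on_coordinatewise_then_product continuous_on_subset[OF continuous_on_product_coordinates]; simp)+
  define K where "K = ev -` C \<inter> od -` D"
  have "closed K"
    unfolding K_def using C(1) D(1) ev od by (intro closed_Int closed_vimage) auto
  moreover have "continuous_map (top_of_set K) (prod_topology T T') (\<lambda>a. (f (ev a), g (od a)))"
  proof (intro continuous_map_pairedI)
    have "continuous_map (top_of_set K) (top_of_set C) ev" "continuous_map (top_of_set K) (top_of_set D) od"
      using ev od by (auto simp: K_def)
    then show "continuous_map (top_of_set K) T (\<lambda>a. f (ev a))"
      "continuous_map (top_of_set K) T' (\<lambda>a. g (od a))"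
      using continuous_map_compose[of _ _ ev, OF _ C(2)] continuous_map_compose[of _ _ od, OF _ D(2)]
      unfolding o_def by blast+
  qed
  moreover have "(\<lambda>a. (f (ev a), g (od a))) ` K = A \<times> B"
  proof (intro set_eqI iffI)
    fix z assume "z \<in> A \<times> B"
    then obtain a b where ab: "a \<in> C" "b \<in> D" "z = (f a, g b)" using C(3) D(3) by auto
    define c where "c k = (if even k then a (k div 2) else b (k div 2))" for k
    have "ev c = a" "od c = b" by (auto simp: ev_def od_def c_def)
    then show "z \<in> (\<lambda>a. (f (ev a), g (od a))) ` K"
      using ab by (intro image_eqI[of _ _ c]) (auto simp: K_def)
  qed (auto simp: K_def C(3) D(3))
  ultimately show ?thesis using analytic_inI by metis
qed

text \<open>Analytic sets are not closed under complements, so the induction carries each set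
  together with its complement. A countable union on one side is a countable intersection on the
  other.\<close>

lemma analytic_in_sigma_sets:
  assumes T: "Hausdorff_space T" and top: "analytic_in T (topspace T)"
    and G: "\<And>A. A \<in> G \<Longrightarrow> analytic_in T A" "\<And>A. A \<in> G \<Longrightarrow> analytic_in T (topspace T - A)"
    and A: "A \<in> sigma_sets (topspace T) G"
  shows "analytic_in T A"
proof -
  have "analytic_in T A \<and> analytic_in T (topspace T - A)"
    using A
  proof induction
    case (Compl A)
    then show ?case using analytic_in_subset[of T A] by (simp add: double_diff)
  next
    case (Union A)
    have "topspace T - (\<Union>i. A i) = (\<Inter>i. topspace T - A i)" by auto
    then show ?case using Union analytic_in_UN[of T A] analytic_in_INT[OF T, of "\<lambda>i. topspace T - A i"] by simp
  qed (use G top in auto)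
  then show ?thesis ..
qed

lemma analytic_in_closedin:
  assumes "analytic_in T (topspace T)" "closedin T K"
  shows "analytic_in T K"
proof -
  obtain C f where C: "closed (C :: (nat \<Rightarrow> nat) set)" "continuous_map (top_of_set C) T f" "topspace T = f ` C"
    using assms(1) by (auto simp: analytic_in_def)
  have "closedin (top_of_set C) {a \<in> C. f a \<in> K}"
    using closedin_continuous_map_preimage[OF C(2) assms(2)] by simp
  then have "closed {a \<in> C. f a \<in> K}" using C(1) closedin_closed_eq by blast
  moreover have "continuous_map (top_of_set {a \<in> C. f a \<in> K}) T f"
    using continuous_map_from_subtopology_mono[OF C(2)] by auto
  moreover have "f ` {a \<in> C. f a \<in> K} = K"
    using closedin_subset[OF assms(2)] C(3) by auto
  ultimately show ?thesis using analytic_inI by metis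
qed

text \<open>By continuity every point of \<open>U\<close> has a code with an initial segment that
  already forces the image into \<open>U\<close>, and there are only countably many finite
  words.\<close>

lemma analytic_in_openin:
  assumes "analytic_in T (topspace T)" "openin T U"
  shows "analytic_in T U"
proof -
  obtain C f where C: "closed (C :: (nat \<Rightarrow> nat) set)" "continuous_map (top_of_set C) T f" "topspace T = f ` C"
    using assms(1) by (auto simp: analytic_in_def)
  define I where "I = {s. f ` (C \<inter> cylinder s) \<subseteq> U}"
  have "U = (\<Union>s\<in>I. f ` (C \<inter> cylinder s))"
  proof
    show "U \<subseteq> (\<Union>s\<in>I. f ` (C \<inter> cylinder s))"
    proof
      fix x assume x: "x \<in> U"
      then obtain a where a: "a \<in> C" "x = f a" using openin_subset[OF assms(2)] C(3) by auto
      then obtain n where n: "\<forall>b\<in>C. (\<forall>i<n. b i = a i) \<longrightarrow> f b \<in> U"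
        using continuous_map_seqD[OF C(2) _ assms(2), of a] x by blast
      then have "map a [0..<n] \<in> I" by (auto simp: I_def)
      then show "x \<in> (\<Union>s\<in>I. f ` (C \<inter> cylinder s))" using a by force
    qed
  qed (auto simp: I_def)
  then show ?thesis
    using analytic_in_countable_UN[of I T "\<lambda>s. f ` (C \<inter> cylinder s)"] analytic_in_cylinder_image[OF C(1,2)]
    by auto
qed

lemma analytic_in_borel_in:
  assumes "Hausdorff_space T" "analytic_in T (topspace T)" "A \<in> borel_in T"
  shows "analytic_in T A"
proof (rule analytic_in_sigma_sets[OF assms(1,2)])
  show "A \<in> sigma_sets (topspace T) {U. openin T U}" using assms(3) by (simp add: borel_in_def)
next
  fix U assume "U \<in> {U. openin T U}"
  then show "analytic_in T U" "analytic_in T (topspace T - U)"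
    using analytic_in_openin[OF assms(2)] analytic_in_closedin[OF assms(2)] by blast+
qed

section \<open>Branches through cylinders and Lusin separation\<close>

lemma cylinder_branch:
  assumes "\<And>n. strict_prefix (s n) (s (Suc n))"
  obtains a where "\<And>n. a \<in> cylinder (s n)" "\<And>n. n \<le> length (s n)"
proof -
  have len: "n \<le> length (s n)" for n
  proof (induction n)
    case (Suc n)
    then show ?case using prefix_length_less[OF assms[of n]] by simp
  qed simp
  have mono: "prefix (s m) (s n)" if "m \<le> n" for m n
    using that by (induction rule: dec_induct) (auto intro: prefix_order.trans prefix_order.less_imp_le[OF assms])
  \<comment> \<open>The word with index \<open>Suc i\<close> is the first one certain to have an
    entry at position \<open>i\<close>.\<close>
  define a where "a i = s (Suc i) ! i" for i
  have "a i = s n ! i" if "i < length (s n)" for n i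
  proof -
    have "i < length (s (Suc i))" using len[of "Suc i"] by simp
    moreover have "prefix (s n) (s (Suc i)) \<or> prefix (s (Suc i)) (s n)"
      using mono nat_le_linear by blast
    ultimately show ?thesis using that by (auto simp: a_def prefix_def nth_append)
  qed
  then have "a \<in> cylinder (s n)" for n by (simp add: cylinder_def)
  then show ?thesis using that len by blast
qed

lemma cylinder_branch_closed:
  assumes "closed C" "\<And>n. a \<in> cylinder (s n)" "\<And>n. n \<le> length (s n)" "\<And>n. C \<inter> cylinder (s n) \<noteq> {}"
  shows "a \<in> C"
proof (rule closed_seqD[OF assms(1)])
  fix n
  obtain b where "b \<in> C" "b \<in> cylinder (s n)" using assms(4) by blast
  then show "\<exists>b\<in>C. \<forall>i<n. b i = a i"
    using assms(2,3)[of n] by (intro bexI[of _ b]) (auto simp: cylinder_def)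
qed

lemma cylinder_branch_continuous:
  assumes "continuous_map (top_of_set C) T f" "a \<in> C" "openin T U" "f a \<in> U"
    "\<And>n. a \<in> cylinder (s n)" "\<And>n. n \<le> length (s n)"
  shows "\<exists>n. \<forall>m\<ge>n. f ` (C \<inter> cylinder (s m)) \<subseteq> U"
proof -
  obtain n where n: "\<forall>b\<in>C. (\<forall>i<n. b i = a i) \<longrightarrow> f b \<in> U"
    using continuous_map_seqD[OF assms(1-4)] by auto
  have "f b \<in> U" if "m \<ge> n" "b \<in> C" "b \<in> cylinder (s m)" for m b
  proof -
    have "\<forall>i<n. b i = a i"
      using that assms(5,6)[of m] by (auto simp: cylinder_def)
    then show ?thesis using n that(2) by blast
  qed
  then show ?thesis by blast
qed

text \<open>Inseparability passes to some pair of one-step extensions, since countably many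
  separating sets could be combined. Iterating yields one branch in each domain. The two image
  points differ, hence have disjoint open neighbourhoods, and by continuity one of these separates
  the images of late cylinders.\<close>

lemma Lusin_separation:
  assumes T: "Hausdorff_space T" and "analytic_in T A" "analytic_in T B" "A \<inter> B = {}"
  obtains D where "D \<in> borel_in T" "A \<subseteq> D" "D \<inter> B = {}"
proof -
  obtain C f where C: "closed (C :: (nat \<Rightarrow> nat) set)" "continuous_map (top_of_set C) T f" "A = f ` C"
    using assms(2) by (auto simp: analytic_in_def)
  obtain C' g where C': "closed (C' :: (nat \<Rightarrow> nat) set)" "continuous_map (top_of_set C') T g" "B = g ` C'"
    using assms(3) by (auto simp: analytic_in_def)
  define sep where "sep A B \<longleftrightarrow> (\<exists>D\<in>borel_in T. A \<subseteq> D \<and> D \<inter> B = {})" for A B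
  interpret sigma_algebra "topspace T" "borel_in T"
    unfolding borel_in_def by (rule sigma_algebra_sigma_sets) (auto dest: openin_subset)
  \<comment> \<open>The separating set has to contain each \<open>A' i\<close> and avoid every
    \<open>B' j\<close>: for fixed \<open>i\<close> intersect over \<open>j\<close>, then unite over
    \<open>i\<close>.\<close>
  have sepUN: "sep (\<Union>i. A' i) (\<Union>j. B' j)" if sep: "\<And>i j. sep (A' i) (B' j)" for A' B' :: "nat \<Rightarrow> 'a set"
  proof -
    obtain D where D: "\<And>i j. D i j \<in> borel_in T \<and> A' i \<subseteq> D i j \<and> D i j \<inter> B' j = {}"
      using sep unfolding sep_def by metis
    show ?thesis unfolding sep_def
    proof (intro bexI[of _ "\<Union>i. \<Inter>j. D i j"] conjI)
      show "(\<Union>i. \<Inter>j. D i j) \<in> borel_in T"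
        using D by (intro countable_UN countable_INT) auto
    qed (use D in blast)+
  qed
  have "sep A B"
  proof (rule ccontr)
    assume nsep: "\<not> sep A B"
    define N where "N st \<longleftrightarrow> \<not> sep (f ` (C \<inter> cylinder (fst st))) (g ` (C' \<inter> cylinder (snd st)))" for st
    have "\<exists>st'. N st' \<and> strict_prefix (fst st) (fst st') \<and> strict_prefix (snd st) (snd st')" if N: "N st" for st
    proof -
      have split: "h ` (K \<inter> cylinder s) = (\<Union>i. h ` (K \<inter> cylinder (s @ [i])))" for h :: "_ \<Rightarrow> 'a" and K s
        by (subst cylinder_extensions) blast
      obtain i j where "N (fst st @ [i], snd st @ [j])"
        using N sepUN[of "\<lambda>i. f ` (C \<inter> cylinder (fst st @ [i]))" "\<lambda>j. g ` (C' \<inter> cylinder (snd st @ [j]))"]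
        unfolding N_def fst_conv snd_conv split[of f C "fst st", symmetric] split[of g C' "snd st", symmetric]
        by meson
      then show ?thesis by (intro exI[of _ "(fst st @ [i], snd st @ [j])"]) (simp add: strict_prefix_def)
    qed
    moreover have "N ([], [])" using nsep C(3) C'(3) by (simp add: N_def)
    ultimately obtain st where st: "\<And>n. N (st n)"
        "\<And>n. strict_prefix (fst (st n)) (fst (st (Suc n))) \<and> strict_prefix (snd (st n)) (snd (st (Suc n)))"
      using dependent_nat_choice[of "\<lambda>_. N" "\<lambda>_ st st'. strict_prefix (fst st) (fst st') \<and> strict_prefix (snd st) (snd st')"]
      by metis
    obtain a where a: "\<And>n. a \<in> cylinder (fst (st n))" "\<And>n. n \<le> length (fst (st n))"
      using cylinder_branch[of "\<lambda>n. fst (st n)"] st(2) by blast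
    obtain b where b: "\<And>n. b \<in> cylinder (snd (st n))" "\<And>n. n \<le> length (snd (st n))"
      using cylinder_branch[of "\<lambda>n. snd (st n)"] st(2) by blast
    \<comment> \<open>An empty image is separated from anything by a trivial Borel set, so
      inseparable cylinders meet their domains.\<close>
    have ne: "C \<inter> cylinder (fst (st n)) \<noteq> {}" "C' \<inter> cylinder (snd (st n)) \<noteq> {}" for n
    proof -
      have "sep {} X" for X unfolding sep_def by (intro bexI[of _ "{}"]) auto
      moreover have "sep X {}" if "X \<subseteq> topspace T" for X
        unfolding sep_def using that by (intro bexI[of _ "topspace T"]) auto
      moreover have "f ` (C \<inter> cylinder s) \<subseteq> topspace T" for s
        using C(2) by (auto simp: continuous_map_def)
      ultimately show "C \<inter> cylinder (fst (st n)) \<noteq> {}" "C' \<inter> cylinder (snd (st n)) \<noteq> {}"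
        using st(1)[of n] unfolding N_def by (metis image_empty)+
    qed
    have aC: "a \<in> C" by (rule cylinder_branch_closed[OF C(1) a ne(1)])
    have bC: "b \<in> C'" by (rule cylinder_branch_closed[OF C'(1) b ne(2)])
    have "f a \<noteq> g b" using aC bC C(3) C'(3) assms(4) by auto
    moreover have "f a \<in> topspace T" "g b \<in> topspace T"
      using aC bC C(2) C'(2) by (auto simp: continuous_map_def)
    ultimately obtain U V where UV: "openin T U" "openin T V" "f a \<in> U" "g b \<in> V" "disjnt U V"
      using T unfolding Hausdorff_space_def by metis
    obtain n where n: "\<forall>m\<ge>n. f ` (C \<inter> cylinder (fst (st m))) \<subseteq> U"
      using cylinder_branch_continuous[OF C(2) aC UV(1,3), of "\<lambda>n. fst (st n)"] a by auto
    obtain n' where n': "\<forall>m\<ge>n'. g ` (C' \<inter> cylinder (snd (st m))) \<subseteq> V"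
      using cylinder_branch_continuous[OF C'(2) bC UV(2,4), of "\<lambda>n. snd (st n)"] b by auto
    have "f ` (C \<inter> cylinder (fst (st (max n n')))) \<subseteq> U" "g ` (C' \<inter> cylinder (snd (st (max n n')))) \<subseteq> V"
      using n n' by simp_all
    moreover have "U \<in> borel_in T" using UV(1) by (auto simp: borel_in_def)
    ultimately have "sep (f ` (C \<inter> cylinder (fst (st (max n n'))))) (g ` (C' \<inter> cylinder (snd (st (max n n')))))"
      unfolding sep_def using UV(5) by (intro bexI[of _ U] conjI) (auto simp: disjnt_def)
    then show False using st(1) by (auto simp: N_def)
  qed
  then show ?thesis using that by (auto simp: sep_def)
qed

section \<open>Coding a Polish space by sequences\<close>

text \<open>A code lists indices of dense points converging at a prescribed rate. By the last
  property, any choice at each level of an open set around \<open>y\<close> is a code of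
  \<open>y\<close>; so a code can be found by deciding countably many open conditions on
  \<open>y\<close>.\<close>

lemma Polish_scheme:
  assumes "completely_metrizable_space T" "second_countable T"
  obtains V :: "nat \<Rightarrow> nat \<Rightarrow> 'a set" and C f where
    "closed C" "continuous_map (top_of_set C) T f"
    "\<And>n i. openin T (V n i)" "\<And>n. topspace T \<subseteq> (\<Union>i. V n i)"
    "\<And>y \<alpha>. y \<in> topspace T \<Longrightarrow> (\<And>n. y \<in> V n (\<alpha> n)) \<Longrightarrow> \<alpha> \<in> C \<and> f \<alpha> = y"
proof (cases "topspace T = {}")
  case True
  show ?thesis
    by (rule that[of "{}" undefined "\<lambda>_ _. {}"]) (use True in \<open>auto simp: continuous_map_def\<close>)
next
  case False
  obtain X d where Xd: "Metric_space X d" "Metric_space.mcomplete X d" "T = Metric_space.mtopology X d"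
    using assms(1) by (auto simp: completely_metrizable_space_def)
  interpret Metric_space X d by (fact Xd(1))
  have top: "topspace T = X" by (simp add: Xd(3))
  obtain Q where Q: "countable Q" "Q \<subseteq> X" "T closure_of Q = X"
    using second_countable_imp_separable_space[OF assms(2)] by (auto simp: separable_space_def top)
  have "Q \<noteq> {}" using Q(3) False top by auto
  define q where "q = from_nat_into Q"
  have q: "range q = Q" unfolding q_def using \<open>Q \<noteq> {}\<close> Q(1) by (rule range_from_nat_into)
  then have qX [simp]: "q i \<in> X" for i using Q(2) by blast
  have dense: "\<exists>i. d (q i) x < r" if "x \<in> X" "r > 0" for x r
  proof -
    have "x \<in> mtopology closure_of Q" using that Q(3) Xd(3) by simp
    then have "\<exists>y\<in>Q. y \<in> mball x r" unfolding metric_closure_of using that by blast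
    then show ?thesis unfolding q[symmetric] by (auto simp: commute)
  qed
  \<comment> \<open>The bound is the triangle inequality through a point at distance less than
    \<open>(1/2)^n\<close> from the n-th dense point. Each instance concerns two entries only, which
    makes \<open>C\<close> closed, and in the limit it leaves the error
    \<open>(1/2)^n\<close>.\<close>
  define C where "C = {\<alpha>. \<forall>m n. d (q (\<alpha> m)) (q (\<alpha> n)) \<le> (1/2)^m + (1/2)^n}"
  define f where "f \<alpha> = (SOME l. limitin mtopology (\<lambda>n. q (\<alpha> n)) l sequentially)" for \<alpha> :: "nat \<Rightarrow> nat"
  have small: "\<exists>n. (1/2)^n < (e::real)" if "e > 0" for e
    using real_arch_pow_inv[OF that, of "1/2"] by simp
  have lim: "f \<alpha> \<in> X" "d (q (\<alpha> n)) (f \<alpha>) \<le> (1/2)^n" if "\<alpha> \<in> C" for \<alpha> n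
  proof -
    have C: "d (q (\<alpha> m)) (q (\<alpha> n)) \<le> (1/2)^m + (1/2)^n" for m n using that by (simp add: C_def)
    have "MCauchy (\<lambda>n. q (\<alpha> n))"
      unfolding MCauchy_def
    proof (intro conjI allI impI)
      fix e :: real assume "e > 0"
      then obtain N where N: "(1/2)^N < e/2" using small[of "e/2"] by auto
      show "\<exists>N. \<forall>n n'. N \<le> n \<longrightarrow> N \<le> n' \<longrightarrow> d (q (\<alpha> n)) (q (\<alpha> n')) < e"
      proof (intro exI allI impI)
        fix n n' assume "N \<le> n" "N \<le> n'"
        then have "(1/2::real)^n \<le> (1/2)^N" "(1/2::real)^n' \<le> (1/2)^N"
          by (simp_all add: power_decreasing)
        then show "d (q (\<alpha> n)) (q (\<alpha> n')) < e" using C[of n n'] N by linarith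
      qed
    qed auto
    then have "\<exists>l. limitin mtopology (\<lambda>n. q (\<alpha> n)) l sequentially"
      using Xd(2) by (simp add: mcomplete_def)
    then have l: "limitin mtopology (\<lambda>n. q (\<alpha> n)) (f \<alpha>) sequentially"
      unfolding f_def by (rule someI_ex)
    then show fX: "f \<alpha> \<in> X" by (rule limitin_mspace)
    show "d (q (\<alpha> n)) (f \<alpha>) \<le> (1/2)^n"
    proof (rule field_le_epsilon)
      fix e :: real assume e: "e > 0"
      then obtain N where N: "\<forall>n\<ge>N. d (q (\<alpha> n)) (f \<alpha>) < e/2"
        using l unfolding limit_metric_sequentially by (meson half_gt_zero)
      obtain N' where N': "(1/2)^N' < e/2" using small[of "e/2"] e by auto
      define m where "m = max N N'"
      have "(1/2::real)^m \<le> (1/2)^N'" by (simp add: power_decreasing m_def)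
      moreover have "d (q (\<alpha> m)) (f \<alpha>) < e/2" using N by (simp add: m_def)
      moreover have "d (q (\<alpha> n)) (f \<alpha>) \<le> d (q (\<alpha> n)) (q (\<alpha> m)) + d (q (\<alpha> m)) (f \<alpha>)"
        using fX by (simp add: triangle)
      ultimately show "d (q (\<alpha> n)) (f \<alpha>) \<le> (1/2)^n + e" using C[of n m] N' by linarith
    qed
  qed
  show ?thesis
  proof (rule that[of C f "\<lambda>n i. mball (q i) ((1/2)^n)"])
    show "closed C"
    proof (rule closed_seqI)
      fix a assume a: "\<And>n. \<exists>b\<in>C. \<forall>i<n. b i = a i"
      have "d (q (a m)) (q (a n)) \<le> (1/2)^m + (1/2)^n" for m n
      proof -
        obtain b where "b \<in> C" "\<forall>i<Suc (max m n). b i = a i" using a by blast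
        then have "b m = a m" "b n = a n" by (simp_all add: less_Suc_eq_le)
        moreover have "d (q (b m)) (q (b n)) \<le> (1/2)^m + (1/2)^n"
          using \<open>b \<in> C\<close> unfolding C_def by blast
        ultimately show ?thesis by simp
      qed
      then show "a \<in> C" by (simp add: C_def)
    qed
    show "continuous_map (top_of_set C) T f"
    proof (rule continuous_map_seqI)
      fix a U assume a: "a \<in> C" "openin T U" "f a \<in> U"
      then obtain r where r: "r > 0" "mball (f a) r \<subseteq> U"
        unfolding Xd(3) openin_mtopology by blast
      then obtain n where n: "(1/2)^n < r/2" using small[of "r/2"] by auto
      have "f b \<in> U" if "b \<in> C" "\<forall>i<Suc n. b i = a i" for b
      proof -
        have "d (q (a n)) (f a) \<le> (1/2)^n" "d (q (a n)) (f b) \<le> (1/2)^n"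
          using lim[OF a(1)] lim(2)[OF that(1), of n] that(2) by auto
        moreover have "d (f a) (f b) \<le> d (q (a n)) (f a) + d (q (a n)) (f b)"
          using lim(1) a(1) that(1) by (metis commute qX triangle)
        ultimately have "f b \<in> mball (f a) r" using lim(1) a(1) that(1) n by simp
        then show ?thesis using r(2) by blast
      qed
      then show "\<exists>n. \<forall>b\<in>C. (\<forall>i<n. b i = a i) \<longrightarrow> f b \<in> U" by blast
    qed (simp add: lim(1) top)
    show "openin T (mball (q i) ((1/2)^n))" for n i by (simp add: Xd(3))
    show "topspace T \<subseteq> (\<Union>i. mball (q i) ((1/2)^n))" for n
    proof
      fix x assume "x \<in> topspace T"
      then show "x \<in> (\<Union>i. mball (q i) ((1/2)^n))" using dense[of x "(1/2)^n"] by (auto simp: top)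
    qed
    fix y \<alpha> assume y: "y \<in> topspace T" "\<And>n. y \<in> mball (q (\<alpha> n)) ((1/2)^n)"
    have yX: "y \<in> X" and dy: "d (q (\<alpha> n)) y < (1/2)^n" for n using y by (auto simp: top)
    have "d (q (\<alpha> m)) (q (\<alpha> n)) \<le> (1/2)^m + (1/2)^n" for m n
      using triangle[of "q (\<alpha> m)" y "q (\<alpha> n)"] dy[of m] dy[of n] yX commute[of y "q (\<alpha> n)"] by simp
    then have \<alpha>: "\<alpha> \<in> C" by (simp add: C_def)
    have "f \<alpha> = y"
    proof (rule ccontr)
      assume "f \<alpha> \<noteq> y"
      then have "d (f \<alpha>) y > 0" using lim(1)[OF \<alpha>] yX by (simp add: mdist_pos_less)
      then obtain n where n: "(1/2)^n < d (f \<alpha>) y / 2" using small[of "d (f \<alpha>) y / 2"] by auto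
      have "d (f \<alpha>) y \<le> d (q (\<alpha> n)) (f \<alpha>) + d (q (\<alpha> n)) y"
        using triangle[of "f \<alpha>" "q (\<alpha> n)" y] lim(1)[OF \<alpha>] yX commute[of "f \<alpha>" "q (\<alpha> n)"] by simp
      then show False using lim(2)[OF \<alpha>, of n] dy[of n] n by linarith
    qed
    then show "\<alpha> \<in> C \<and> f \<alpha> = y" using \<alpha> by blast
  qed
qed

section \<open>The Lusin-Novikov theorem\<close>

lemma standard_borelE:
  assumes "standard_borel M"
  obtains T where "completely_metrizable_space T" "second_countable T"
    "topspace T = space M" "sets M = borel_in T" "Hausdorff_space T"
proof -
  obtain T where T: "completely_metrizable_space T" "second_countable T"
    "topspace T = space M" "sets M = sigma_sets (space M) {U. openin T U}"
    using assms by (auto simp: standard_borel_def)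
  moreover have "Hausdorff_space T"
    using T(1) by (simp add: completely_metrizable_imp_metrizable_space metrizable_imp_Hausdorff_space)
  ultimately show ?thesis using that by (simp add: borel_in_def)
qed

lemma analytic_in_Polish_topspace:
  assumes "completely_metrizable_space T" "second_countable T"
  shows "analytic_in T (topspace T)"
proof -
  obtain V :: "nat \<Rightarrow> nat \<Rightarrow> 'a set" and C f where V: "closed C" "continuous_map (top_of_set C) T f"
    "\<And>n i. openin T (V n i)" "\<And>n. topspace T \<subseteq> (\<Union>i. V n i)"
    "\<And>y \<alpha>. y \<in> topspace T \<Longrightarrow> (\<And>n. y \<in> V n (\<alpha> n)) \<Longrightarrow> \<alpha> \<in> C \<and> f \<alpha> = y"
    by (rule Polish_scheme[OF assms]) blast
  have "topspace T = f ` C"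
  proof
    show "topspace T \<subseteq> f ` C"
    proof
      fix y assume y: "y \<in> topspace T"
      then have "\<forall>n. \<exists>i. y \<in> V n i" using V(4) by blast
      then obtain \<alpha> where "\<And>n. y \<in> V n (\<alpha> n)" by metis
      then show "y \<in> f ` C" using V(5)[OF y] by blast
    qed
    show "f ` C \<subseteq> topspace T" using V(2) by (auto simp: continuous_map_def)
  qed
  then show ?thesis using analytic_inI V(1,2) by metis
qed

text \<open>The countably many open sets of the coding scheme separate points, so equality is a
  countable conjunction of Borel conditions.\<close>

lemma pred_eq_standard_borel:
  assumes M: "standard_borel M" and f: "f \<in> measurable N M" and g: "g \<in> measurable N M"
  shows "Measurable.pred N (\<lambda>z. f z = g z)"
proof -
  obtain T where T: "completely_metrizable_space T" "second_countable T"
    "topspace T = space M" "sets M = borel_in T"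
    using standard_borelE[OF M] by metis
  obtain V :: "nat \<Rightarrow> nat \<Rightarrow> _" and C and h where V: "closed C" "continuous_map (top_of_set C) T h"
    "\<And>n i. openin T (V n i)" "\<And>n. topspace T \<subseteq> (\<Union>i. V n i)"
    "\<And>y \<alpha>. y \<in> topspace T \<Longrightarrow> (\<And>n. y \<in> V n (\<alpha> n)) \<Longrightarrow> \<alpha> \<in> C \<and> h \<alpha> = y"
    by (rule Polish_scheme[OF T(1,2)]) blast
  have [measurable]: "V n i \<in> sets M" for n i
    using V(3) by (auto simp: T(4) borel_in_def)
  note [measurable] = f g
  have "x = y" if "x \<in> space M" "y \<in> space M" "\<forall>n i. x \<in> V n i \<longleftrightarrow> y \<in> V n i" for x y
  proof -
    have "\<forall>n. \<exists>i. x \<in> V n i" using V(4) that(1) T(3) by blast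
    then obtain \<alpha> where \<alpha>: "\<And>n. x \<in> V n (\<alpha> n)" by metis
    moreover from this have "\<And>n. y \<in> V n (\<alpha> n)" using that(3) by blast
    ultimately have "h \<alpha> = x" "h \<alpha> = y" using V(5) that(1,2) T(3) by blast+
    then show ?thesis by simp
  qed
  then have "f z = g z \<longleftrightarrow> (\<forall>n i. f z \<in> V n i \<longleftrightarrow> g z \<in> V n i)" if "z \<in> space N" for z
    using measurable_space[OF f that] measurable_space[OF g that] by metis
  moreover have "Measurable.pred N (\<lambda>z. \<forall>n i. f z \<in> V n i \<longleftrightarrow> g z \<in> V n i)" by measurable
  ultimately show ?thesis by (subst measurable_cong)
qed

text \<open>Because \<open>A\<close> is functional, the points with value inside
  \<open>V n i\<close> and those with value outside form disjoint analytic sets. Lusin separation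
  turns the location of the value into Borel conditions on \<open>x\<close>, from which a code of
  the value is read off.\<close>

lemma analytic_functional_subset_graph:
  assumes T: "completely_metrizable_space T" "second_countable T"
    and M: "space M = topspace T" "sets M = borel_in T"
    and A: "analytic_in (prod_topology T T) A"
    and fn: "\<And>x y y'. (x, y) \<in> A \<Longrightarrow> (x, y') \<in> A \<Longrightarrow> y = y'"
  obtains F where "F \<in> measurable M M" "\<And>x y. (x, y) \<in> A \<Longrightarrow> F x = y"
proof -
  have H: "Hausdorff_space T" "Hausdorff_space (prod_topology T T)"
    using T(1) by (simp_all add: completely_metrizable_imp_metrizable_space metrizable_imp_Hausdorff_space
        Hausdorff_space_prod_topology)
  note top = analytic_in_Polish_topspace[OF T]
  have AX: "A \<subseteq> topspace T \<times> topspace T" using analytic_in_subset[OF A] by simp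
  obtain V :: "nat \<Rightarrow> nat \<Rightarrow> 'a set" and C and f where V: "closed C" "continuous_map (top_of_set C) T f"
    "\<And>n i. openin T (V n i)" "\<And>n. topspace T \<subseteq> (\<Union>i. V n i)"
    "\<And>y \<alpha>. y \<in> topspace T \<Longrightarrow> (\<And>n. y \<in> V n (\<alpha> n)) \<Longrightarrow> \<alpha> \<in> C \<and> f \<alpha> = y"
    by (rule Polish_scheme[OF T]) blast
  have an: "analytic_in T (fst ` (A \<inter> topspace T \<times> W))" if "analytic_in T W" for W
    using analytic_in_image[OF analytic_in_Int[OF H(2) A analytic_in_Times[OF top that]] continuous_map_fst] .
  have "\<exists>D\<in>borel_in T. fst ` (A \<inter> topspace T \<times> V n i) \<subseteq> D \<and>
        D \<inter> fst ` (A \<inter> topspace T \<times> (topspace T - V n i)) = {}" for n i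
  proof -
    have "analytic_in T (V n i)" "analytic_in T (topspace T - V n i)"
      using analytic_in_openin[OF top] analytic_in_closedin[OF top] V(3) by blast+
    moreover have "fst ` (A \<inter> topspace T \<times> V n i) \<inter> fst ` (A \<inter> topspace T \<times> (topspace T - V n i)) = {}"
      using fn by fastforce
    ultimately obtain D where "D \<in> borel_in T" "fst ` (A \<inter> topspace T \<times> V n i) \<subseteq> D"
        "D \<inter> fst ` (A \<inter> topspace T \<times> (topspace T - V n i)) = {}"
      using Lusin_separation[OF H(1) an an] by metis
    then show ?thesis by blast
  qed
  then obtain D where D: "\<And>n i. D n i \<in> sets M" "\<And>n i. fst ` (A \<inter> topspace T \<times> V n i) \<subseteq> D n i"
    "\<And>n i. D n i \<inter> fst ` (A \<inter> topspace T \<times> (topspace T - V n i)) = {}"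
    unfolding M(2) by metis
  have D_iff: "x \<in> D n i \<longleftrightarrow> y \<in> V n i" if "(x, y) \<in> A" for x y n i
  proof -
    have "x \<in> topspace T" "y \<in> topspace T" using that AX by auto
    then show ?thesis using D(2,3)[of n i] that by force
  qed
  \<comment> \<open>The least index makes the choice of a code measurable. Off the projection of
    \<open>A\<close> the resulting sequence has no particular meaning.\<close>
  define a where "a x n = (LEAST i. x \<in> D n i)" for x n
  note D(1)[measurable]
  have "(\<lambda>x. a x n) \<in> measurable M (count_space UNIV)" for n
    unfolding a_def by measurable
  then have "(\<lambda>x. a x n) \<in> borel_measurable M" for n
    by (rule measurable_compose) simp
  then have a: "a \<in> borel_measurable M"
    by (intro measurable_coordinatewise_then_product)
  \<comment> \<open>The fallback \<open>x\<close> keeps \<open>F\<close> a total measurable map on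
    the space when the sequence is not a code.\<close>
  define F where "F x = (if a x \<in> C then f (a x) else x)" for x
  have "F \<in> measurable M M"
  proof (rule measurable_sigma_sets)
    show "sets M = sigma_sets (topspace T) {U. openin T U}" by (simp add: M borel_in_def)
    show "F \<in> space M \<rightarrow> topspace T" using V(2) by (auto simp: F_def M continuous_map_def)
    show "{U. openin T U} \<subseteq> Pow (topspace T)" by (auto dest: openin_subset)
    fix U assume "U \<in> {U. openin T U}"
    then have U: "openin T U" by simp
    then have "openin (top_of_set C) {\<alpha> \<in> C. f \<alpha> \<in> U}"
      using V(2) by (simp add: continuous_map_def)
    then obtain W where W: "open W" "{\<alpha> \<in> C. f \<alpha> \<in> U} = C \<inter> W" by (auto simp: openin_open)
    have [measurable]: "U \<in> sets M" "W \<in> sets borel" "C \<in> sets borel" "a \<in> borel_measurable M"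
      using U W(1) V(1) a by (auto simp: M(2) borel_in_def)
    have "F -` U \<inter> space M = {x \<in> space M. a x \<in> C \<and> a x \<in> W \<or> a x \<notin> C \<and> x \<in> U}"
    proof -
      have "f \<alpha> \<in> U \<longleftrightarrow> \<alpha> \<in> W" if "\<alpha> \<in> C" for \<alpha>
        using W(2) that by blast
      then show ?thesis by (auto simp: F_def split: if_split_asm)
    qed
    also have "\<dots> \<in> sets M" by measurable
    finally show "F -` U \<inter> space M \<in> sets M" .
  qed
  moreover have "F x = y" if xy: "(x, y) \<in> A" for x y
  proof -
    have y: "y \<in> topspace T" using xy AX by auto
    have "y \<in> V n (a x n)" for n
    proof -
      have "\<exists>i. y \<in> V n i" using V(4) y by blast
      then have "\<exists>i. x \<in> D n i" using D_iff[OF xy] by simp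
      then have "x \<in> D n (a x n)" unfolding a_def by (rule LeastI_ex)
      then show ?thesis using D_iff[OF xy] by simp
    qed
    then show ?thesis using V(5)[OF y, of "a x"] by (simp add: F_def)
  qed
  ultimately show ?thesis using that by blast
qed

text \<open>If every countable family of graphs leaves something of \<open>E\<close>, a minimal
  remainder branches so richly that a single section contains a point outside any given enumeration
  of it, contradicting countability.\<close>

lemma Lusin_Novikov_cover:
  assumes M: "standard_borel M" and E: "E \<in> sets (M \<Otimes>\<^sub>M M)"
    and cnt: "\<And>x. x \<in> space M \<Longrightarrow> countable (E `` {x})"
  obtains F :: "nat \<Rightarrow> 'a \<Rightarrow> 'a" where
    "\<And>n. F n \<in> measurable M M" "\<And>x y. (x, y) \<in> E \<Longrightarrow> \<exists>n. F n x = y"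
proof -
  obtain T where T: "completely_metrizable_space T" "second_countable T"
    "topspace T = space M" "sets M = borel_in T" and HT: "Hausdorff_space T"
    using standard_borelE[OF M] by metis
  note top = analytic_in_Polish_topspace[OF T(1,2)]
  have HTT: "Hausdorff_space (prod_topology T T)" using HT by (simp add: Hausdorff_space_prod_topology)
  have anM: "analytic_in T A" if "A \<in> sets M" for A
    using analytic_in_borel_in[OF HT top] that T(4) by simp
  \<comment> \<open>The product sigma-algebra is generated by rectangles, and the complement of a
    rectangle is a union of two rectangles; so the induction runs over rectangles directly, without
    comparison to the Borel sets of the product topology.\<close>
  have anMM: "analytic_in (prod_topology T T) B" if "B \<in> sets (M \<Otimes>\<^sub>M M)" for B
  proof (rule analytic_in_sigma_sets[OF HTT])
    show "analytic_in (prod_topology T T) (topspace (prod_topology T T))"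
      using analytic_in_Times[OF top top] by simp
    show "B \<in> sigma_sets (topspace (prod_topology T T)) {a \<times> b |a b. a \<in> sets M \<and> b \<in> sets M}"
      using that by (simp add: sets_pair_measure T(3))
    fix R assume "R \<in> {a \<times> b |a b. a \<in> sets M \<and> b \<in> sets M}"
    then obtain a b where ab: "R = a \<times> b" "a \<in> sets M" "b \<in> sets M" by blast
    show "analytic_in (prod_topology T T) R"
      unfolding ab(1) using ab by (intro analytic_in_Times anM)
    have "topspace (prod_topology T T) - R = (space M - a) \<times> space M \<union> space M \<times> (space M - b)"
      using ab(1) T(3) by auto
    then show "analytic_in (prod_topology T T) (topspace (prod_topology T T) - R)"
      using ab by (auto intro!: analytic_in_Un analytic_in_Times anM)
  qed
  \<comment> \<open>A small set is what countably many Borel graphs leave of \<open>E\<close>; the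
    goal is that the empty set is small.\<close>
  define small where "small Y \<longleftrightarrow> (\<exists>F :: nat \<Rightarrow> 'a \<Rightarrow> 'a. (\<forall>n. F n \<in> measurable M M) \<and>
      Y = {(x, y) \<in> E. \<forall>n. F n x \<noteq> y})" for Y
  have small_sets: "Y \<in> sets (M \<Otimes>\<^sub>M M)" if "small Y" for Y
  proof -
    obtain F :: "nat \<Rightarrow> 'a \<Rightarrow> 'a" where F [measurable]: "\<And>n. F n \<in> measurable M M"
      and Y: "Y = {(x, y) \<in> E. \<forall>n. F n x \<noteq> y}"
      using \<open>small Y\<close> unfolding small_def by blast
    have [measurable]: "Measurable.pred (M \<Otimes>\<^sub>M M) (\<lambda>z. F n (fst z) = snd z)" for n
      by (intro pred_eq_standard_borel[OF M]) measurable
    have "Y = {z \<in> space (M \<Otimes>\<^sub>M M). z \<in> E \<and> (\<forall>n. F n (fst z) \<noteq> snd z)}"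
      using sets.sets_into_space[OF E] by (auto simp: Y)
    also have "\<dots> \<in> sets (M \<Otimes>\<^sub>M M)" using E by measurable
    finally show ?thesis .
  qed
  have small_INT: "small (\<Inter>k. Y k)" if Y: "\<And>k::nat. small (Y k)" for Y
  proof -
    obtain F :: "nat \<Rightarrow> nat \<Rightarrow> 'a \<Rightarrow> 'a" where F: "\<And>k n. F k n \<in> measurable M M"
      "\<And>k. Y k = {(x, y) \<in> E. \<forall>n. F k n x \<noteq> y}"
    proof -
      have "\<forall>k. \<exists>F :: nat \<Rightarrow> 'a \<Rightarrow> 'a. (\<forall>n. F n \<in> measurable M M) \<and> Y k = {(x, y) \<in> E. \<forall>n. F n x \<noteq> y}"
        using Y unfolding small_def by simp
      from choice[OF this] show ?thesis using that by blast
    qed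
    have "(\<Inter>k. Y k) = {(x, y) \<in> E. \<forall>m. (case prod_decode m of (k, n) \<Rightarrow> F k n) x \<noteq> y}"
    proof -
      have "(\<forall>m. (case prod_decode m of (k, n) \<Rightarrow> F k n) x \<noteq> y) \<longleftrightarrow> (\<forall>k n. F k n x \<noteq> y)" for x y
        by (metis (no_types, lifting) case_prod_conv old.prod.exhaust prod_encode_inverse)
      then show ?thesis unfolding F(2) by auto
    qed
    moreover have "(case prod_decode m of (k, n) \<Rightarrow> F k n) \<in> measurable M M" for m
      using F(1) by (auto split: prod.split)
    ultimately show ?thesis unfolding small_def
      by (intro exI[of _ "\<lambda>m. case prod_decode m of (k, n) \<Rightarrow> F k n"]) simp
  qed
  have small_E: "small {(x, y) \<in> E. G x \<noteq> y}" if "G \<in> measurable M M" for G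
    unfolding small_def using that by (intro exI[of _ "\<lambda>_. G"]) auto
  have small_Int: "small (Y \<inter> Z)" if "small Y" "small Z" for Y Z
    using small_INT[of "\<lambda>k. if k = 0 then Y else Z"] that unfolding INT_nat_if by presburger
  have "small {}"
  proof (rule ccontr)
    assume nsmall: "\<not> small {}"
    obtain C h where C: "closed (C :: (nat \<Rightarrow> nat) set)"
      "continuous_map (top_of_set C) (prod_topology T T) h" "E = h ` C"
      using anMM[OF E] by (auto simp: analytic_in_def)
    have h1: "continuous_map (top_of_set C) T (\<lambda>a. fst (h a))"
      and h2: "continuous_map (top_of_set C) T (\<lambda>a. snd (h a))"
      using C(2) by (auto simp: continuous_map_pairwise o_def)
    define R where "R s = h ` (C \<inter> cylinder s)" for s
    \<comment> \<open>These are the first coordinates above which every cylinder named by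
      \<open>U\<close> still contains a pair of \<open>Y\<close>. Keeping this set nonempty is the
      invariant of the tree.\<close>
    define K where "K Y U = (\<Inter>s\<in>U. fst ` (R s \<inter> Y))" for Y :: "('a \<times> 'a) set" and U :: "nat list set"
    define Fin where "Fin = {U :: nat list set. finite U \<and> U \<noteq> {}}"
    have "countable (Collect finite :: nat list set set)"
      using countable_Collect_finite by simp
    then have Fin: "countable Fin" "Fin \<noteq> {}"
      by (auto simp: Fin_def intro: countable_subset)
    \<comment> \<open>For each \<open>U\<close> a small set is fixed that empties \<open>K\<close>
      whenever any small set does.\<close>
    obtain Z where Z: "\<And>U. small (Z U)" "\<And>U Y. small Y \<Longrightarrow> K Y U = {} \<Longrightarrow> K (Z U) U = {}"
    proof -
      have "\<forall>U. \<exists>Z. small Z \<and> (\<forall>Y. small Y \<longrightarrow> K Y U = {} \<longrightarrow> K Z U = {})"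
      proof
        fix U
        show "\<exists>Z. small Z \<and> (\<forall>Y. small Y \<longrightarrow> K Y U = {} \<longrightarrow> K Z U = {})"
        proof (cases "\<exists>Y. small Y \<and> K Y U = {}")
          case False
          then show ?thesis using small_E[OF measurable_ident] by blast
        qed blast
      qed
      from choice[OF this] show ?thesis using that by blast
    qed
    \<comment> \<open>Small sets are closed under countable intersections and \<open>K\<close> is
      monotone in its first argument, so this one set is as destructive as possible for all finite
      nonempty \<open>U\<close> at once.\<close>
    define Y0 where "Y0 = (\<Inter>n. Z (from_nat_into Fin n))"
    have Y0: "small Y0" unfolding Y0_def by (rule small_INT) (rule Z(1))
    have K_mono: "K Y U \<subseteq> K Y' U" if "Y \<subseteq> Y'" for Y Y' U
      unfolding K_def using that by blast
    have Y0_min: "K Y0 U = {}" if U: "U \<in> Fin" "small Y" "K Y U = {}" for Y U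
    proof -
      obtain n where "from_nat_into Fin n = U" using from_nat_into_surj[OF Fin(1) U(1)] by blast
      then have "Y0 \<subseteq> Z U" unfolding Y0_def by blast
      then show ?thesis using K_mono Z(2)[OF U(2,3)] by blast
    qed
    define good where "good U \<longleftrightarrow> U \<in> Fin \<and> K Y0 U \<noteq> {}" for U
    have good0: "good {[]}"
    proof -
      have "{[]} \<in> Fin" by (simp add: Fin_def)
      moreover have "Y0 \<noteq> {}" using Y0 nsmall by auto
      moreover have "Y0 \<subseteq> E" using Y0 by (auto simp: small_def)
      ultimately show ?thesis using C(3) by (auto simp: good_def K_def R_def)
    qed
    have anR: "analytic_in (prod_topology T T) (R s)" for s
      unfolding R_def by (rule analytic_in_cylinder_image[OF C(1,2)])
    define forks where "forks s U \<longleftrightarrow> (\<exists>s1\<in>U. \<exists>s2\<in>U. strict_prefix s s1 \<and> strict_prefix s s2 \<and>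
        snd ` R s1 \<inter> snd ` R s2 = {})" for s U
    have R_mono: "R t \<subseteq> R s" if "prefix s t" for s t
      using that by (fastforce simp: R_def cylinder_def prefix_def nth_append)
    \<comment> \<open>The pairs of \<open>Y0\<close> in the cylinder \<open>s\<close> above
      \<open>K Y0 U\<close> cannot form a function. Otherwise one more Borel graph would remove them
      and empty \<open>K\<close>, against the minimality of \<open>Y0\<close>. Two values above one
      \<open>x\<close> give the fork.\<close>
    have fork1: "\<exists>U'. good U' \<and> (\<forall>t\<in>U. \<exists>t'\<in>U'. strict_prefix t t') \<and> forks s U'"
      if U: "good U" "s \<in> U" for U s
    proof -
      have fin: "finite U" "U \<noteq> {}" using U(1) by (auto simp: good_def Fin_def)
      define A where "A = R s \<inter> Y0 \<inter> (K Y0 U \<times> space M)"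
      have anY0: "analytic_in (prod_topology T T) (R t \<inter> Y0)" for t
        by (intro analytic_in_Int[OF HTT] anR anMM small_sets Y0)
      have "analytic_in T (K Y0 U)"
        unfolding K_def
        by (rule analytic_in_finite_INT[OF HT fin analytic_in_image[OF anY0 continuous_map_fst]])
      then have anA: "analytic_in (prod_topology T T) A"
        unfolding A_def by (rule analytic_in_Int[OF HTT anY0 analytic_in_Times[OF _ anM[OF sets.top]]])
      have "\<not> (\<forall>x y y'. (x, y) \<in> A \<longrightarrow> (x, y') \<in> A \<longrightarrow> y = y')"
      proof
        assume "\<forall>x y y'. (x, y) \<in> A \<longrightarrow> (x, y') \<in> A \<longrightarrow> y = y'"
        then obtain G where G: "G \<in> measurable M M" "\<And>x y. (x, y) \<in> A \<Longrightarrow> G x = y"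
          using analytic_functional_subset_graph[OF T(1,2) T(3)[symmetric] T(4) anA] by metis
        define Y where "Y = Y0 \<inter> {(x, y) \<in> E. G x \<noteq> y}"
        have "small Y" unfolding Y_def by (intro small_Int Y0 small_E G(1))
        then obtain x where x: "x \<in> K Y U"
          using Y0_min[of U Y] U(1) by (auto simp: good_def)
        then have "x \<in> fst ` (R s \<inter> Y)" using U(2) by (auto simp: K_def)
        then obtain y where y: "(x, y) \<in> R s" "(x, y) \<in> Y" by auto
        have "x \<in> K Y0 U" using x K_mono[of Y Y0 U] by (auto simp: Y_def)
        moreover have "y \<in> space M" using y(1) analytic_in_subset[OF anR] T(3) by auto
        ultimately have "(x, y) \<in> A" using y by (auto simp: A_def Y_def)
        then show False using G(2) y(2) by (auto simp: Y_def)
      qed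
      then obtain x y y' where xy: "(x, y) \<in> A" "(x, y') \<in> A" "y \<noteq> y'" by blast
      obtain a where a: "a \<in> C" "a \<in> cylinder s" "h a = (x, y)"
        using xy(1) by (auto simp: A_def R_def)
      obtain a' where a': "a' \<in> C" "a' \<in> cylinder s" "h a' = (x, y')"
        using xy(2) by (auto simp: A_def R_def)
      have "\<forall>t\<in>U. \<exists>c. c \<in> C \<and> c \<in> cylinder t \<and> h c \<in> Y0 \<and> fst (h c) = x"
        using xy(1) by (fastforce simp: A_def K_def R_def)
      \<comment> \<open>Every word of \<open>U\<close> is lengthened along a point above this same
        \<open>x\<close>; thus \<open>x\<close> stays common to all new words.\<close>
      then obtain c where c: "\<And>t. t \<in> U \<Longrightarrow> c t \<in> C \<and> c t \<in> cylinder t \<and> h (c t) \<in> Y0 \<and> fst (h (c t)) = x"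
        by metis
      have "y \<in> topspace T" "y' \<in> topspace T" using xy by (auto simp: A_def T(3))
      then obtain W W' where W: "openin T W" "openin T W'" "y \<in> W" "y' \<in> W'" "disjnt W W'"
        using HT xy(3) unfolding Hausdorff_space_def by metis
      obtain n1 where n1: "\<forall>b\<in>C. (\<forall>i<n1. b i = a i) \<longrightarrow> snd (h b) \<in> W"
        using continuous_map_seqD[OF h2 a(1) W(1)] a(3) W(3) by auto
      obtain n2 where n2: "\<forall>b\<in>C. (\<forall>i<n2. b i = a' i) \<longrightarrow> snd (h b) \<in> W'"
        using continuous_map_seqD[OF h2 a'(1) W(2)] a'(3) W(4) by auto
      obtain n3 where n3: "\<And>t. t \<in> U \<Longrightarrow> length t < n3"
        using fin(1) finite_nat_set_iff_bounded[of "length ` U"] by auto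
      \<comment> \<open>\<open>n1\<close> and \<open>n2\<close> make the two second coordinates fall
        into disjoint open sets, while \<open>n3\<close> makes every extension strict.\<close>
      define n where "n = max n1 (max n2 n3)"
      have pre: "strict_prefix t (map b [0..<n])" if "b \<in> cylinder t" "t \<in> U" for b t
      proof -
        have len: "length t < n" using n3[OF that(2)] by (simp add: n_def)
        have "t = take (length t) (map b [0..<n])"
          using that(1) len by (intro nth_equalityI) (auto simp: cylinder_def)
        then have "prefix t (map b [0..<n])" by (metis take_is_prefix)
        then show ?thesis using len by (auto simp: strict_prefix_def)
      qed
      define U' where "U' = (\<lambda>b. map b [0..<n]) ` (c ` U \<union> {a, a'})"
      have "U' \<in> Fin" using fin by (auto simp: Fin_def U'_def)
      moreover have "x \<in> K Y0 U'"
      proof -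
        have "x \<in> fst ` (R (map b [0..<n]) \<inter> Y0)" if "b \<in> c ` U \<union> {a, a'}" for b
        proof (rule image_eqI)
          have b: "b \<in> C \<and> h b \<in> Y0 \<and> fst (h b) = x"
            using that c a a' xy(1,2) by (auto simp: A_def)
          then show "x = fst (h b)" by simp
          show "h b \<in> R (map b [0..<n]) \<inter> Y0" using b by (auto simp: R_def)
        qed
        then show ?thesis by (auto simp: K_def U'_def)
      qed
      ultimately have "good U'" by (auto simp: good_def)
      moreover have "\<forall>t\<in>U. \<exists>t'\<in>U'. strict_prefix t t'"
        using pre c by (auto simp: U'_def)
      moreover have "forks s U'"
      proof -
        have "snd ` R (map a [0..<n]) \<subseteq> W"
        proof -
          have "snd (h b) \<in> W" if "b \<in> C" "\<forall>i<n. b i = a i" for b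
            using that n1 by (simp add: n_def)
          then show ?thesis by (auto simp: R_def)
        qed
        moreover have "snd ` R (map a' [0..<n]) \<subseteq> W'"
        proof -
          have "snd (h b) \<in> W'" if "b \<in> C" "\<forall>i<n. b i = a' i" for b
            using that n2 by (simp add: n_def)
          then show ?thesis by (auto simp: R_def)
        qed
        ultimately have "snd ` R (map a [0..<n]) \<inter> snd ` R (map a' [0..<n]) = {}"
          using W(5) by (auto simp: disjnt_def)
        then show ?thesis unfolding forks_def
          using pre[OF a(2) U(2)] pre[OF a'(2) U(2)]
          by (intro bexI[of _ "map a [0..<n]"] bexI[of _ "map a' [0..<n]"]) (auto simp: U'_def)
      qed
      ultimately show ?thesis by blast
    qed
    have fork_mono: "forks s U'" if U: "forks s U" "\<forall>t\<in>U. \<exists>t'\<in>U'. prefix t t'" for s U U'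
    proof -
      obtain s1 s2 where s: "s1 \<in> U" "s2 \<in> U" "strict_prefix s s1" "strict_prefix s s2"
        "snd ` R s1 \<inter> snd ` R s2 = {}" using U(1) by (auto simp: forks_def)
      obtain t1 t2 where t: "t1 \<in> U'" "t2 \<in> U'" "prefix s1 t1" "prefix s2 t2"
        using U(2) s(1,2) by blast
      have "strict_prefix s t1" "strict_prefix s t2"
        using s(3,4) t(3,4) prefix_order.less_le_trans by blast+
      moreover have "snd ` R t1 \<inter> snd ` R t2 = {}"
        using s(5) R_mono[OF t(3)] R_mono[OF t(4)] by blast
      ultimately show ?thesis unfolding forks_def using t by blast
    qed
    \<comment> \<open>Words are forked one at a time. Later extensions preserve the forks already
      made, since cylinder images only shrink.\<close>
    have fork_all: "\<exists>U'. good U' \<and> (\<forall>s\<in>U. forks s U')" if U: "good U" for U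
    proof -
      have finU: "finite U" using U by (auto simp: good_def Fin_def)
      have "\<exists>U'. good U' \<and> (\<forall>t\<in>U. \<exists>t'\<in>U'. prefix t t') \<and> (\<forall>s\<in>W. forks s U')"
        if "W \<subseteq> U" for W
        using finite_subset[OF that finU] that
      proof (induction W rule: finite_induct)
        case empty
        then show ?case using U by blast
      next
        case (insert s W)
        then obtain U' where U': "good U'" "\<forall>t\<in>U. \<exists>t'\<in>U'. prefix t t'" "\<forall>s\<in>W. forks s U'" by auto
        obtain s' where s': "s' \<in> U'" "prefix s s'" using U'(2) insert.prems by blast
        obtain U'' where U'': "good U''" "\<forall>t\<in>U'. \<exists>t'\<in>U''. strict_prefix t t'" "forks s' U''"
          using fork1[OF U'(1) s'(1)] by blast
        have ext: "\<forall>t\<in>U'. \<exists>t'\<in>U''. prefix t t'" using U''(2) prefix_order.less_imp_le by blast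
        have "forks s U''"
          using U''(3) s'(2) prefix_order.le_less_trans unfolding forks_def by blast
        moreover have "\<forall>s\<in>W. forks s U''" using U'(3) fork_mono ext by blast
        moreover have "\<forall>t\<in>U. \<exists>t'\<in>U''. prefix t t'"
          using U'(2) ext prefix_order.order_trans by meson
        ultimately show ?case using U''(1) by blast
      qed
      then show ?thesis by blast
    qed
    obtain U where U: "\<And>n. good (U n)" "\<And>n s. s \<in> U n \<Longrightarrow> forks s (U (Suc n))"
    proof -
      have "\<exists>U. \<forall>n. good (U n) \<and> (\<forall>s\<in>U n. forks s (U (Suc n)))"
        using dependent_nat_choice[of "\<lambda>_. good" "\<lambda>_ U U'. \<forall>s\<in>U. forks s U'"] good0 fork_all by metis
      then show ?thesis using that by blast
    qed
    have branch: "\<exists>a\<in>C. \<forall>n. a \<in> cylinder (s n) \<and> n \<le> length (s n)"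
      if s: "\<And>n. s n \<in> U n" "\<And>n. strict_prefix (s n) (s (Suc n))" for s
    proof -
      obtain a where a: "\<And>n. a \<in> cylinder (s n)" "\<And>n. n \<le> length (s n)"
        using cylinder_branch[of s] s(2) by blast
      have "C \<inter> cylinder (s n) \<noteq> {}" for n
        using U(1)[of n] s(1)[of n] by (auto simp: good_def K_def R_def)
      then have "a \<in> C" using cylinder_branch_closed[OF C(1) a] by blast
      then show ?thesis using a by blast
    qed
    \<comment> \<open>At each level all cylinders of \<open>U m\<close> have images with a common
      first coordinate, so the images of two branches can never be driven into disjoint open
      sets.\<close>
    have same: "fst (h a) = fst (h b)"
      if s: "\<And>n. s n \<in> U n" "a \<in> C" "\<And>n. a \<in> cylinder (s n)" "\<And>n. n \<le> length (s n)"
        and t: "\<And>n. t n \<in> U n" "b \<in> C" "\<And>n. b \<in> cylinder (t n)" "\<And>n. n \<le> length (t n)"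
      for s t a b
    proof (rule ccontr)
      assume ne: "fst (h a) \<noteq> fst (h b)"
      have "fst (h a) \<in> topspace T" "fst (h b) \<in> topspace T"
        using h1 s(2) t(2) by (auto simp: continuous_map_def)
      then obtain W W' where W: "openin T W" "openin T W'" "fst (h a) \<in> W" "fst (h b) \<in> W'" "disjnt W W'"
        using HT ne unfolding Hausdorff_space_def by metis
      obtain n1 where n1: "\<forall>m\<ge>n1. (\<lambda>a. fst (h a)) ` (C \<inter> cylinder (s m)) \<subseteq> W"
        using cylinder_branch_continuous[OF h1 s(2) W(1,3) s(3,4)] by blast
      obtain n2 where n2: "\<forall>m\<ge>n2. (\<lambda>a. fst (h a)) ` (C \<inter> cylinder (t m)) \<subseteq> W'"
        using cylinder_branch_continuous[OF h1 t(2) W(2,4) t(3,4)] by blast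
      define m where "m = max n1 n2"
      obtain x where "x \<in> K Y0 (U m)" using U(1)[of m] by (auto simp: good_def)
      then have "x \<in> fst ` R (s m)" "x \<in> fst ` R (t m)"
        using s(1) t(1) unfolding K_def by blast+
      moreover have "fst ` R (s m) \<subseteq> W" "fst ` R (t m) \<subseteq> W'"
        using n1 n2 by (simp_all add: m_def R_def image_image)
      ultimately show False using W(5) by (auto simp: disjnt_def)
    qed
    have nonempty: "\<exists>s. s \<in> U 0" using U(1)[of 0] by (auto simp: good_def Fin_def)
    \<comment> \<open>At level \<open>n\<close> the current word has two extensions with disjoint
      sets of second coordinates. The value \<open>e n\<close> lies in at most one of them, and the
      other is chosen.\<close>
    have chain: "\<exists>s. \<forall>n. s n \<in> U n \<and> strict_prefix (s n) (s (Suc n)) \<and> e n \<notin> snd ` R (s (Suc n))"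
      for e :: "nat \<Rightarrow> 'a"
    proof -
      have "\<exists>s'. s' \<in> U (Suc n) \<and> strict_prefix s s' \<and> e n \<notin> snd ` R s'" if "s \<in> U n" for s n
        using U(2)[OF that] unfolding forks_def by blast
      then show ?thesis
        by (intro dependent_nat_choice[of "\<lambda>n s. s \<in> U n" "\<lambda>n s s'. strict_prefix s s' \<and> e n \<notin> snd ` R s'"]
            nonempty)
    qed
    \<comment> \<open>The section to be enumerated is known only once \<open>x\<close> is. A first
      branch, built against an arbitrary sequence, reveals \<open>x\<close>; a second one is then
      built against the enumeration, and \<open>same\<close> places it above the same
      \<open>x\<close>.\<close>
    obtain s a where s: "\<And>n. s n \<in> U n" "a \<in> C" "\<And>n. a \<in> cylinder (s n)" "\<And>n. n \<le> length (s n)"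
      using chain[of undefined] branch by metis
    define x where "x = fst (h a)"
    have "x \<in> space M" using h1 s(2) T(3) by (auto simp: continuous_map_def x_def)
    then have cx: "countable (E `` {x})" by (rule cnt)
    define e where "e = from_nat_into (E `` {x})"
    obtain t where t: "\<And>n. t n \<in> U n" "\<And>n. strict_prefix (t n) (t (Suc n))"
      "\<And>n. e n \<notin> snd ` R (t (Suc n))" using chain[of e] by blast
    obtain b where b: "b \<in> C" "\<And>n. b \<in> cylinder (t n)" "\<And>n. n \<le> length (t n)"
      using branch[of t] t by blast
    have "fst (h b) = x" using same[OF s t(1) b] by (simp add: x_def)
    then have "snd (h b) \<in> E `` {x}" using C(3) b(1) by (metis Image_singleton_iff imageI prod.collapse)
    then obtain n where "e n = snd (h b)"
      using from_nat_into_surj[OF cx] unfolding e_def by blast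
    moreover have "snd (h b) \<in> snd ` R (t (Suc n))" using b by (auto simp: R_def)
    ultimately show False using t(3) by metis
  qed
  then show ?thesis using that unfolding small_def by blast
qed

lemma Lusin_Novikov_enumeration:
  assumes M: "standard_borel M" and E: "countable_borel_equiv M E"
  obtains g :: "nat \<Rightarrow> 'a \<Rightarrow> 'a" where
    "\<And>n. g n \<in> measurable M M" "\<And>x. x \<in> space M \<Longrightarrow> E `` {x} = range (\<lambda>n. g n x)"
proof -
  have eq: "equiv (space M) E" and Es [measurable]: "E \<in> sets (M \<Otimes>\<^sub>M M)"
    and cnt: "\<And>x. x \<in> space M \<Longrightarrow> countable (E `` {x})"
    using E by (auto simp: countable_borel_equiv_def)
  obtain F :: "nat \<Rightarrow> 'a \<Rightarrow> 'a" where F [measurable]: "\<And>n. F n \<in> measurable M M"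
    and EF: "\<And>x y. (x, y) \<in> E \<Longrightarrow> \<exists>n. F n x = y"
    using Lusin_Novikov_cover[OF M Es cnt] by blast
  \<comment> \<open>Where a covering map leaves the class, its value is replaced by
    \<open>x\<close>, which belongs to the class by reflexivity.\<close>
  define g where "g n x = (if (x, F n x) \<in> E then F n x else x)" for n x
  show ?thesis
  proof (rule that)
    show "g n \<in> measurable M M" for n unfolding g_def by measurable
    show "E `` {x} = range (\<lambda>n. g n x)" if x: "x \<in> space M" for x
    proof
      have "(x, x) \<in> E" using eq x by (meson equiv_def refl_onD)
      then show "range (\<lambda>n. g n x) \<subseteq> E `` {x}" by (auto simp: g_def)
      show "E `` {x} \<subseteq> range (\<lambda>n. g n x)"
      proof
        fix y assume "y \<in> E `` {x}"
        then have xy: "(x, y) \<in> E" by simp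
        then obtain n where "F n x = y" using EF by blast
        then have "y = g n x" using xy by (simp add: g_def)
        then show "y \<in> range (\<lambda>n. g n x)" by blast
      qed
    qed
  qed
qed

lemma standard_borel_separates_finite:
  assumes "standard_borel M"
  obtains V :: "nat \<Rightarrow> 'a set" where "\<And>i. V i \<in> sets M"
    "\<And>A x. finite A \<Longrightarrow> A \<subseteq> space M \<Longrightarrow> x \<in> A \<Longrightarrow> \<exists>i. V i \<inter> A = {x}"
proof -
  obtain T where T: "second_countable T" "topspace T = space M" "sets M = borel_in T" "Hausdorff_space T"
    using standard_borelE[OF assms] by metis
  obtain B where B: "countable B" "\<forall>V\<in>B. openin T V"
    "\<forall>U x. openin T U \<and> x \<in> U \<longrightarrow> (\<exists>V\<in>B. x \<in> V \<and> V \<subseteq> U)"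
    using T(1) unfolding second_countable_def by blast
  \<comment> \<open>Inserting the empty set makes the enumeration legitimate even for an empty
    base.\<close>
  define V where "V = from_nat_into (insert {} B)"
  have V: "range V = insert {} B" unfolding V_def using B(1) by (simp add: range_from_nat_into)
  show ?thesis
  proof (rule that[of V])
    fix i
    have "V i \<in> insert {} B" using V by blast
    then show "V i \<in> sets M" using B(2) by (auto simp: T(3) borel_in_def)
  next
    fix A x assume A: "finite A" "A \<subseteq> space M" "x \<in> A"
    have "openin T (topspace T - (A - {x}))"
      using A T(2,4) by (intro openin_diff openin_topspace closedin_Hausdorff_finite) auto
    moreover have "x \<in> topspace T - (A - {x})" using A T(2) by auto
    ultimately obtain W where W: "W \<in> B" "x \<in> W" "W \<subseteq> topspace T - (A - {x})"
      using B(3) by metis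
    then obtain i where "V i = W" using V by (metis imageE insertI2)
    then show "\<exists>i. V i \<inter> A = {x}" using W A by (intro exI[of _ i]) blast
  qed
qed

section \<open>Borel families of finite sets\<close>

lemma infsum_finite_support:
  fixes f :: "'a \<Rightarrow> 'b::{comm_monoid_add, t2_space}"
  assumes "finite B" "B \<subseteq> A" "\<And>x. x \<in> A - B \<Longrightarrow> f x = 0"
  shows "infsum f A = sum f B"
proof -
  have "infsum f A = infsum f B" using assms by (intro infsum_cong_neutral) auto
  then show ?thesis using assms(1) by simp
qed

text \<open>The elements of \<open>H\<close> have the ranks 0, 1, 2, ... without gaps. Rank 0 is
  skipped because, among the stages covering a point, it marks the first cover, when the point is
  still fresh and receives nothing.\<close>

lemma infinite_nat_initial_ranks:
  fixes H :: "nat set" and k :: nat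
  assumes "infinite H"
  defines "Z \<equiv> {n \<in> H. 1 \<le> card (H \<inter> {..<n}) \<and> card (H \<inter> {..<n}) \<le> k}"
  shows "finite Z" "card Z = k"
proof -
  have bij: "bij_betw (enumerate H) UNIV H" using assms(1) by (rule bij_enumerate)
  have rank: "card (H \<inter> {..<enumerate H i}) = i" for i
  proof -
    have "H \<inter> {..<enumerate H i} = enumerate H ` {..<i}"
    proof (intro set_eqI iffI)
      fix n assume "n \<in> H \<inter> {..<enumerate H i}"
      then obtain j where "n = enumerate H j" "enumerate H j < enumerate H i"
        using bij unfolding bij_betw_def by auto
      then show "n \<in> enumerate H ` {..<i}" using assms(1) by simp
    qed (use assms(1) enumerate_in_set in auto)
    then show ?thesis using inj_enumerate[OF assms(1)] by (simp add: card_image inj_on_subset)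
  qed
  have "Z = enumerate H ` {1..k}"
  proof (intro set_eqI iffI)
    fix n assume n: "n \<in> Z"
    then obtain i where "n = enumerate H i" using bij unfolding bij_betw_def Z_def by blast
    then show "n \<in> enumerate H ` {1..k}" using n rank[of i] by (auto simp: Z_def)
  qed (use rank assms(1) enumerate_in_set in \<open>auto simp: Z_def\<close>)
  then show "finite Z" "card Z = k"
    using inj_enumerate[OF assms(1)] by (simp_all add: card_image inj_on_subset)
qed

section \<open>Borel conditions and sums along an enumeration of the classes\<close>

locale enumerated_cocycle =
  fixes M :: "'a measure" and E :: "('a \<times> 'a) set" and w :: "'a \<Rightarrow> 'a \<Rightarrow> real"
    and g :: "nat \<Rightarrow> 'a \<Rightarrow> 'a"
  assumes standard: "standard_borel M"
    and cber: "countable_borel_equiv M E"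
    and cocycle: "borel_cocycle M E w"
    and g [measurable]: "g n \<in> measurable M M"
    and class_eq: "x \<in> space M \<Longrightarrow> E `` {x} = range (\<lambda>n. g n x)"
begin

lemma equiv: "equiv (space M) E"
  and sets_E [measurable]: "E \<in> sets (M \<Otimes>\<^sub>M M)"
  using cber by (auto simp: countable_borel_equiv_def)

lemma E_refl: "x \<in> space M \<Longrightarrow> (x, x) \<in> E"
  and E_sym: "(x, y) \<in> E \<Longrightarrow> (y, x) \<in> E"
  and E_trans: "(x, y) \<in> E \<Longrightarrow> (y, z) \<in> E \<Longrightarrow> (x, z) \<in> E"
  using equiv by (auto simp: equiv_def refl_on_def dest: symD transD)

lemma E_space: "(x, y) \<in> E \<Longrightarrow> x \<in> space M" "(x, y) \<in> E \<Longrightarrow> y \<in> space M"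
  using sets.sets_into_space[OF sets_E] by (auto simp: space_pair_measure)

lemma g_in_class: "x \<in> space M \<Longrightarrow> (x, g n x) \<in> E"
  using class_eq by blast

lemma g_space: "x \<in> space M \<Longrightarrow> g n x \<in> space M"
  using g_in_class E_space by blast

lemma class_g: "(x, y) \<in> E \<Longrightarrow> \<exists>n. y = g n x"
  using class_eq[OF E_space(1)] by blast

lemma w_pos: "(x, y) \<in> E \<Longrightarrow> 0 < w x y"
  and w_mult: "(x, y) \<in> E \<Longrightarrow> (y, z) \<in> E \<Longrightarrow> w x y * w y z = w x z"
  using cocycle by (auto simp: borel_cocycle_def)

lemma w_nonneg: "(x, y) \<in> E \<Longrightarrow> 0 \<le> w x y"
  using w_pos by (simp add: less_imp_le)

lemma borel_w: "(\<lambda>x. w x (g n x)) \<in> borel_measurable M"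
proof -
  have "(\<lambda>(x, y). w x y) \<in> borel_measurable (restrict_space (M \<Otimes>\<^sub>M M) E)"
    using cocycle by (simp add: borel_cocycle_def borel_on_rel_def)
  moreover have "(\<lambda>x. (x, g n x)) \<in> measurable M (restrict_space (M \<Otimes>\<^sub>M M) E)"
    by (rule measurable_restrict_space2) (auto simp: g_in_class)
  ultimately have "(\<lambda>x. case (x, g n x) of (x, y) \<Rightarrow> w x y) \<in> borel_measurable M"
    by (rule measurable_compose[rotated])
  then show ?thesis by simp
qed

lemma pred_eq: "f \<in> measurable N M \<Longrightarrow> h \<in> measurable N M \<Longrightarrow> Measurable.pred N (\<lambda>z. f z = h z)"
  by (rule pred_eq_standard_borel[OF standard])

text \<open>\<open>E\<close> is the countable union of the graphs of the maps \<open>g n\<close>,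
  and these graphs are Borel.\<close>

lemma borel_on_relI:
  assumes "\<And>n. (\<lambda>x. f x (g n x)) \<in> borel_measurable M"
  shows "borel_on_rel M E f"
  unfolding borel_on_rel_def
proof (rule measurableI)
  fix B :: "real set" assume B: "B \<in> sets borel"
  have "(\<lambda>(x, y). f x y) -` B \<inter> space (restrict_space (M \<Otimes>\<^sub>M M) E) =
      (\<Union>n. {z \<in> space (M \<Otimes>\<^sub>M M). z \<in> E \<and> g n (fst z) = snd z \<and> f (fst z) (g n (fst z)) \<in> B})"
    (is "?L = (\<Union>n. ?R n)")
  proof (intro set_eqI iffI)
    fix z assume z: "z \<in> ?L"
    then have E: "z \<in> E" and "z \<in> space (M \<Otimes>\<^sub>M M)" and "f (fst z) (snd z) \<in> B"
      using sets.sets_into_space[OF sets_E] by (auto simp: space_restrict_space split: prod.splits)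
    moreover obtain n where "snd z = g n (fst z)"
      using class_g[of "fst z" "snd z"] E by auto
    ultimately have "z \<in> ?R n" by simp
    then show "z \<in> (\<Union>n. ?R n)" by blast
  qed (auto simp: space_restrict_space)
  moreover have "{z \<in> space (M \<Otimes>\<^sub>M M). z \<in> E \<and> g n (fst z) = snd z \<and> f (fst z) (g n (fst z)) \<in> B}
      \<in> sets (M \<Otimes>\<^sub>M M)" for n
  proof -
    have [measurable]: "Measurable.pred (M \<Otimes>\<^sub>M M) (\<lambda>z. g n (fst z) = snd z)"
      by (intro pred_eq) measurable
    note [measurable] = measurable_compose[OF measurable_fst assms[of n]] B
    show ?thesis by measurable
  qed
  ultimately have "(\<lambda>(x, y). f x y) -` B \<inter> space (restrict_space (M \<Otimes>\<^sub>M M) E) \<in> sets (M \<Otimes>\<^sub>M M)"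
    by auto
  then show "(\<lambda>(x, y). f x y) -` B \<inter> space (restrict_space (M \<Otimes>\<^sub>M M) E) \<in> sets (restrict_space (M \<Otimes>\<^sub>M M) E)"
    by (auto simp: sets_restrict_space_iff space_restrict_space)
qed simp

text \<open>Each class sum is a series over those indices \<open>n\<close> at which \<open>g n x\<close> occurs for the first time.\<close>

lemma borel_class_sum:
  fixes F :: "'a \<Rightarrow> 'a \<Rightarrow> ennreal"
  assumes [measurable]: "\<And>n. (\<lambda>x. F x (g n x)) \<in> borel_measurable M"
  shows "(\<lambda>x. \<Sum>\<^sub>\<infinity>y\<in>E `` {x}. F x y) \<in> borel_measurable M"
proof -
  have [measurable]: "Measurable.pred M (\<lambda>x. g m x = g n x)" for m n by (intro pred_eq g)
  have "(\<Sum>\<^sub>\<infinity>y\<in>E `` {x}. F x y) = (\<Sum>n. if \<forall>m<n. g m x \<noteq> g n x then F x (g n x) else 0)"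
    if x: "x \<in> space M" for x
  proof -
    define N where "N = {n. \<forall>m<n. g m x \<noteq> g n x}"
    have "inj_on (\<lambda>n. g n x) N"
    proof (rule inj_onI)
      fix m n assume "m \<in> N" "n \<in> N" "g m x = g n x"
      then show "m = n" by (cases m n rule: linorder_cases) (auto simp: N_def)
    qed
    moreover have "(\<lambda>n. g n x) ` N = E `` {x}"
    proof
      show "E `` {x} \<subseteq> (\<lambda>n. g n x) ` N"
      proof
        fix y assume "y \<in> E `` {x}"
        then obtain n0 where n0: "g n0 x = y" using class_g by blast
        define n where "n = (LEAST n. g n x = y)"
        have "g n x = y" unfolding n_def using n0 by (rule LeastI)
        moreover have "g m x \<noteq> y" if "m < n" for m using that not_less_Least unfolding n_def by blast
        ultimately show "y \<in> (\<lambda>n. g n x) ` N" by (auto simp: N_def)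
      qed
    qed (use class_eq[OF x] in auto)
    ultimately have "(\<Sum>\<^sub>\<infinity>y\<in>E `` {x}. F x y) = (\<Sum>\<^sub>\<infinity>n\<in>N. F x (g n x))"
      by (metis infsum_reindex_bij_betw inj_on_imp_bij_betw)
    also have "\<dots> = (\<Sum>\<^sub>\<infinity>n\<in>UNIV. if n \<in> N then F x (g n x) else 0)"
      by (rule infsum_cong_neutral) auto
    also have "\<dots> = (\<Sum>n. if n \<in> N then F x (g n x) else 0)"
      by (rule sums_unique[OF has_sum_imp_sums[OF has_sum_infsum]]) (simp add: nonneg_summable_on_complete)
    finally show ?thesis by (simp add: N_def)
  qed
  moreover have "(\<lambda>x. \<Sum>n. if \<forall>m<n. g m x \<noteq> g n x then F x (g n x) else 0) \<in> borel_measurable M"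
    by measurable
  ultimately show ?thesis by (subst measurable_cong)
qed

section \<open>Finite subsets of a class as index lists\<close>

definition fam :: "nat list \<Rightarrow> 'a \<Rightarrow> 'a set" where
  "fam J x = (\<lambda>j. g j x) ` set J"

lemma fam_nth: "fam J x = (\<lambda>i. g (J ! i) x) ` {..<length J}"
  unfolding fam_def set_conv_nth by auto

text \<open>A family is tested through one base point at a time instead of through tuples. This form
  is convenient for the recursion on tilings, and \<open>borel_fam_iff\<close> identifies it with
  the quotient structure.\<close>

definition borel_fam :: "'a set set \<Rightarrow> bool" where
  "borel_fam Q \<longleftrightarrow> Q \<subseteq> finite_class_subsets M E \<and> (\<forall>J. Measurable.pred M (\<lambda>x. fam J x \<in> Q))"

lemma finite_class_subsetsD:
  assumes "A \<in> finite_class_subsets M E"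
  shows "finite A" "A \<noteq> {}" "A \<subseteq> space M" "\<And>x. x \<in> A \<Longrightarrow> A \<subseteq> E `` {x}"
  using assms E_space E_sym E_trans unfolding finite_class_subsets_def by blast+

lemma fam_subset_class: "x \<in> space M \<Longrightarrow> fam J x \<subseteq> E `` {x}"
  using g_in_class by (auto simp: fam_def)

lemma fam_onto:
  assumes "finite A" "A \<subseteq> E `` {x}"
  obtains J where "A = fam J x"
proof -
  have "\<exists>J. A = fam J x" using assms
  proof induction
    case empty
    have "{} = fam [] x" by (simp add: fam_def)
    then show ?case by blast
  next
    case (insert y A)
    then obtain J n where "A = fam J x" "y = g n x" using class_g by blast
    then have "insert y A = fam (n # J) x" by (simp add: fam_def)
    then show ?case by blast
  qed
  then show ?thesis using that by blast
qed

lemma borel_famD1: "borel_fam Q \<Longrightarrow> A \<in> Q \<Longrightarrow> A \<in> finite_class_subsets M E"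
  by (auto simp: borel_fam_def)

lemma borel_famD2: "borel_fam Q \<Longrightarrow> h \<in> measurable N M \<Longrightarrow> Measurable.pred N (\<lambda>x. fam J (h x) \<in> Q)"
  unfolding borel_fam_def using measurable_compose[of h N M "\<lambda>x. fam J x \<in> Q"] by blast

lemma pred_in_fam:
  assumes [measurable]: "h \<in> measurable N M" "k \<in> measurable N M"
  shows "Measurable.pred N (\<lambda>x. h x \<in> fam J (k x))"
proof -
  have "Measurable.pred N (\<lambda>x. h x = g j (k x))" for j by (intro pred_eq) measurable
  then have "Measurable.pred N (\<lambda>x. \<exists>j\<in>set J. h x = g j (k x))" by measurable
  also have "(\<lambda>x. \<exists>j\<in>set J. h x = g j (k x)) = (\<lambda>x. h x \<in> fam J (k x))"
    by (auto simp: fam_def)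
  finally show ?thesis .
qed

lemma pred_fam_subset:
  assumes [measurable]: "h \<in> measurable N M" "k \<in> measurable N M"
  shows "Measurable.pred N (\<lambda>x. fam I (h x) \<subseteq> fam J (k x))"
proof -
  have "Measurable.pred N (\<lambda>x. g i (h x) \<in> fam J (k x))" for i by (intro pred_in_fam) measurable
  then have "Measurable.pred N (\<lambda>x. \<forall>i\<in>set I. g i (h x) \<in> fam J (k x))" by measurable
  also have "(\<lambda>x. \<forall>i\<in>set I. g i (h x) \<in> fam J (k x)) = (\<lambda>x. fam I (h x) \<subseteq> fam J (k x))"
    by (auto simp: fam_def)
  finally show ?thesis .
qed

lemma pred_fam_eq:
  assumes "h \<in> measurable N M" "k \<in> measurable N M"
  shows "Measurable.pred N (\<lambda>x. fam I (h x) = fam J (k x))"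
  unfolding set_eq_subset by (intro pred_intros_logic pred_fam_subset assms)

text \<open>A tuple whose range belongs to \<open>Q\<close> lies in one class, so its entries are
  values of the maps \<open>g j\<close> at the entry 0, and countably many lists exhaust the
  possibilities. Conversely, a list defines a measurable map from points to tuples. The empty tuple
  is harmless as members of \<open>Q\<close> are nonempty.\<close>

lemma borel_fam_iff: "borel_fam Q \<longleftrightarrow> Q \<in> borel_families M E"
proof
  assume Q: "borel_fam Q"
  have QF: "Q \<subseteq> finite_class_subsets M E" using Q by (simp add: borel_fam_def)
  have "{f \<in> {..<n} \<rightarrow>\<^sub>E space M. f ` {..<n} \<in> Q} \<in> sets (\<Pi>\<^sub>M i\<in>{..<n}. M)" for n :: nat
  proof (cases "n = 0")
    case True
    then have "{f \<in> {..<n} \<rightarrow>\<^sub>E space M. f ` {..<n} \<in> Q} = {}"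
      using QF by (auto simp: finite_class_subsets_def)
    then show ?thesis by (simp only: sets.empty_sets)
  next
    case False
    let ?N = "\<Pi>\<^sub>M i\<in>{..<n}. M"
    have comp: "(\<lambda>f. f i) \<in> measurable ?N M" if "i < n" for i
      using that by (intro measurable_component_singleton) simp
    have "{f \<in> {..<n} \<rightarrow>\<^sub>E space M. f ` {..<n} \<in> Q} = (\<Union>J\<in>{J. length J = n}.
        {f \<in> space ?N. (\<forall>i\<in>{..<n}. f i = g (J ! i) (f 0)) \<and> fam J (f 0) \<in> Q})"
    proof (intro set_eqI iffI)
      fix f assume f: "f \<in> {f \<in> {..<n} \<rightarrow>\<^sub>E space M. f ` {..<n} \<in> Q}"
      then have "f ` {..<n} \<subseteq> E `` {f 0}"
        using QF False finite_class_subsetsD(4)[of "f ` {..<n}" "f 0"] by auto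
      then have "\<forall>i<n. \<exists>j. f i = g j (f 0)" using class_g by blast
      then obtain j where j: "\<And>i. i < n \<Longrightarrow> f i = g (j i) (f 0)" by metis
      define J where "J = map j [0..<n]"
      have J: "length J = n" "f i = g (J ! i) (f 0)" if "i < n" for i
        using j[OF that] that by (simp_all add: J_def)
      have "fam J (f 0) = f ` {..<n}"
        unfolding fam_nth using J[symmetric] by (intro image_cong) (simp_all add: J_def)
      then have "fam J (f 0) \<in> Q" using f by simp
      moreover have "\<forall>i\<in>{..<n}. f i = g (J ! i) (f 0)" using J by blast
      moreover have "f \<in> space ?N" using f by (simp add: space_PiM)
      moreover have "J \<in> {J. length J = n}" by (simp add: J_def)
      ultimately show "f \<in> (\<Union>J\<in>{J. length J = n}.
        {f \<in> space ?N. (\<forall>i\<in>{..<n}. f i = g (J ! i) (f 0)) \<and> fam J (f 0) \<in> Q})"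
        by blast
    next
      fix f assume "f \<in> (\<Union>J\<in>{J. length J = n}.
        {f \<in> space ?N. (\<forall>i\<in>{..<n}. f i = g (J ! i) (f 0)) \<and> fam J (f 0) \<in> Q})"
      then obtain J where J: "length J = n" "f \<in> space ?N" "\<forall>i\<in>{..<n}. f i = g (J ! i) (f 0)"
        "fam J (f 0) \<in> Q" by blast
      have "fam J (f 0) = f ` {..<n}"
        unfolding fam_nth using J(1) J(3)[rule_format, symmetric] by (intro image_cong) simp_all
      then show "f \<in> {f \<in> {..<n} \<rightarrow>\<^sub>E space M. f ` {..<n} \<in> Q}" using J(2,4) by (simp add: space_PiM)
    qed
    also have "\<dots> \<in> sets ?N"
    proof (intro sets.countable_UN'')
      fix J :: "nat list" assume "J \<in> {J. length J = n}"
      have [measurable]: "Measurable.pred ?N (\<lambda>f. fam J (f 0) \<in> Q)"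
        using False by (intro borel_famD2[OF Q] comp) simp
      have "Measurable.pred ?N (\<lambda>f. f i = g (J ! i) (f 0))" if "i \<in> {..<n}" for i
        using that by (intro pred_eq comp measurable_compose[OF comp g]) auto
      then have [measurable]: "Measurable.pred ?N (\<lambda>f. \<forall>i\<in>{..<n}. f i = g (J ! i) (f 0))"
        by (intro pred_intros_finite) auto
      show "{f \<in> space ?N. (\<forall>i\<in>{..<n}. f i = g (J ! i) (f 0)) \<and> fam J (f 0) \<in> Q} \<in> sets ?N"
        by measurable
    qed simp
    finally show ?thesis .
  qed
  then show "Q \<in> borel_families M E" using QF by (simp add: borel_families_def)
next
  assume Q: "Q \<in> borel_families M E"
  have "Measurable.pred M (\<lambda>x. fam J x \<in> Q)" for J
  proof -
    let ?n = "length J"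
    let ?N = "\<Pi>\<^sub>M i\<in>{..<?n}. M"
    let ?h = "\<lambda>x. \<lambda>i\<in>{..<?n}. g (J ! i) x"
    have h: "?h \<in> measurable M ?N" by (intro measurable_restrict g)
    have "{f \<in> {..<?n} \<rightarrow>\<^sub>E space M. f ` {..<?n} \<in> Q} \<in> sets ?N"
      using Q by (simp add: borel_families_def)
    from measurable_sets[OF h this] have "?h -` {f \<in> {..<?n} \<rightarrow>\<^sub>E space M. f ` {..<?n} \<in> Q} \<inter> space M \<in> sets M" .
    also have "?h -` {f \<in> {..<?n} \<rightarrow>\<^sub>E space M. f ` {..<?n} \<in> Q} \<inter> space M = {x \<in> space M. fam J x \<in> Q}"
    proof -
      have "?h x ` {..<?n} = fam J x" for x
        unfolding fam_nth by (intro image_cong) simp_all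
      moreover have "?h x \<in> {..<?n} \<rightarrow>\<^sub>E space M" if "x \<in> space M" for x
        using g_space[OF that] by auto
      ultimately show ?thesis by auto
    qed
    finally show ?thesis by (simp add: pred_def)
  qed
  then show "borel_fam Q" using Q by (auto simp: borel_fam_def borel_families_def)
qed

text \<open>A set of \<open>Q\<close> containing a point is named by a list based at that very
  point, so the existential quantifier over sets becomes countable.\<close>

lemma pred_Union_fam:
  assumes Q: "borel_fam Q" and h: "h \<in> measurable N M"
  shows "Measurable.pred N (\<lambda>x. h x \<in> \<Union>Q)"
proof -
  have [measurable]: "Measurable.pred N (\<lambda>x. h x \<in> fam J (h x))" for J
    by (intro pred_in_fam h)
  note [measurable] = borel_famD2[OF Q h]
  have "h x \<in> \<Union>Q \<longleftrightarrow> (\<exists>J. h x \<in> fam J (h x) \<and> fam J (h x) \<in> Q)" for x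
  proof
    assume "h x \<in> \<Union>Q"
    then obtain A where A: "A \<in> Q" "h x \<in> A" by blast
    then have "finite A" "A \<subseteq> E `` {h x}" using borel_famD1[OF Q A(1)] finite_class_subsetsD by auto
    then obtain J where "A = fam J (h x)" by (rule fam_onto)
    then show "\<exists>J. h x \<in> fam J (h x) \<and> fam J (h x) \<in> Q" using A by blast
  qed blast
  moreover have "Measurable.pred N (\<lambda>x. \<exists>J. h x \<in> fam J (h x) \<and> fam J (h x) \<in> Q)"
    by measurable
  ultimately show ?thesis by simp
qed

section \<open>Weights and packs\<close>

lemma weight_eq_class_sum:
  assumes "B \<subseteq> E `` {x}"
  shows "weight w x B = (\<Sum>\<^sub>\<infinity>y\<in>E `` {x}. if y \<in> B then ennreal (w x y) else 0)"
  unfolding weight_def using assms by (intro infsum_cong_neutral) auto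

lemma borel_weight:
  assumes "\<And>x. x \<in> space M \<Longrightarrow> B x \<subseteq> E `` {x}"
    and [measurable]: "\<And>n. Measurable.pred M (\<lambda>x. g n x \<in> B x)"
  shows "(\<lambda>x. weight w x (B x)) \<in> borel_measurable M"
proof -
  note [measurable] = borel_w
  have "(\<lambda>x. \<Sum>\<^sub>\<infinity>y\<in>E `` {x}. if y \<in> B x then ennreal (w x y) else 0) \<in> borel_measurable M"
    by (rule borel_class_sum) measurable
  then show ?thesis
    by (subst measurable_cong[OF weight_eq_class_sum[OF assms(1)]])
qed

lemma weight_finite:
  assumes "finite B" "B \<subseteq> E `` {x}"
  shows "weight w x B = ennreal (\<Sum>y\<in>B. w x y)"
proof -
  have "weight w x B = (\<Sum>y\<in>B. ennreal (w x y))"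
    unfolding weight_def using assms(1) by simp
  also have "\<dots> = ennreal (\<Sum>y\<in>B. w x y)"
    using assms(2) by (auto intro!: sum_ennreal w_nonneg)
  finally show ?thesis .
qed

lemma sum_w_rebase:
  assumes "(x', x) \<in> E" "B \<subseteq> E `` {x}"
  shows "(\<Sum>y\<in>B. w x' y) = w x' x * (\<Sum>y\<in>B. w x y)"
  using assms by (auto simp: sum_distrib_left intro!: sum.cong w_mult[symmetric])

text \<open>Changing the base point multiplies both sides of the weight inequality by the same
  positive factor, so one base point decides it. All sets are finite, which permits real
  sums.\<close>

lemma pack_over_iff:
  assumes P: "P \<subseteq> finite_class_subsets M E" and p: "0 \<le> p"
    and A: "A \<in> finite_class_subsets M E" "x \<in> space M" "A \<subseteq> E `` {x}"
  shows "pack_over M E w p P A \<longleftrightarrow> (\<forall>U\<in>P. U \<inter> A \<noteq> {} \<longrightarrow> U \<subseteq> A) \<and>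
    p * (\<Sum>y\<in>A \<inter> \<Union>P. w x y) \<le> (\<Sum>y\<in>A - \<Union>P. w x y)"
proof -
  have "A \<subseteq> space M" "finite A" using finite_class_subsetsD[OF A(1)] by auto
  then have "invariant_under (tiling_rel M P) A \<longleftrightarrow> (\<forall>U\<in>P. U \<inter> A \<noteq> {} \<longrightarrow> U \<subseteq> A)"
    unfolding invariant_under_def tiling_rel_def by blast
  moreover have "ennreal p * weight w x' (A \<inter> \<Union>P) \<le> weight w x' (A - \<Union>P) \<longleftrightarrow>
      p * (\<Sum>y\<in>A \<inter> \<Union>P. w x y) \<le> (\<Sum>y\<in>A - \<Union>P. w x y)"
    if x': "x' \<in> space M" "A \<subseteq> E `` {x'}" for x'
  proof -
    obtain y where "y \<in> A" using finite_class_subsetsD[OF A(1)] by blast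
    then have xx': "(x', x) \<in> E" using A(3) x'(2) E_sym E_trans by blast
    have nonneg: "0 \<le> (\<Sum>y\<in>B. w x y)" if "B \<subseteq> A" for B
      using that A(3) by (auto intro!: sum_nonneg w_nonneg)
    have *: "(\<Sum>y\<in>B. w x' y) = w x' x * (\<Sum>y\<in>B. w x y)" if "B \<subseteq> A" for B
      using that A(3) by (intro sum_w_rebase[OF xx']) blast
    have wt: "weight w x' B = ennreal (\<Sum>y\<in>B. w x' y)" if "B \<subseteq> A" for B
      using that \<open>finite A\<close> x'(2) finite_subset by (intro weight_finite) blast+
    show ?thesis
      using w_pos[OF xx'] p nonneg[of "A \<inter> \<Union>P"] nonneg[of "A - \<Union>P"]
      by (simp add: wt * ennreal_mult[symmetric] ennreal_le_iff mult.left_commute)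
  qed
  ultimately show ?thesis
    unfolding pack_over_def using A by blast
qed

text \<open>A tile meeting \<open>fam J x\<close> contains some \<open>g j x\<close> and has a name
  based at that point. Hence invariance quantifies over a finite list and countably many
  names.\<close>

lemma borel_fam_packs:
  assumes P: "borel_fam P" and S: "borel_fam S" and p: "0 \<le> p"
  shows "borel_fam {A \<in> S. pack_over M E w p P A}"
  unfolding borel_fam_def
proof (intro conjI allI)
  have PF: "P \<subseteq> finite_class_subsets M E" and SF: "S \<subseteq> finite_class_subsets M E"
    using P S by (auto simp: borel_fam_def)
  then show "{A \<in> S. pack_over M E w p P A} \<subseteq> finite_class_subsets M E" by blast
  fix J
  have id: "(\<lambda>x. x) \<in> measurable M M" by simp
  note [measurable] = borel_famD2[OF S id] borel_famD2[OF P g] pred_in_fam[OF g g] pred_fam_subset[OF g id]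
  have [measurable]: "(\<lambda>x. weight w x (fam J x \<inter> \<Union>P)) \<in> borel_measurable M"
    "(\<lambda>x. weight w x (fam J x - \<Union>P)) \<in> borel_measurable M"
  proof -
    have "Measurable.pred M (\<lambda>x. g n x \<in> fam J x \<and> g n x \<in> \<Union>P)"
      "Measurable.pred M (\<lambda>x. g n x \<in> fam J x \<and> g n x \<notin> \<Union>P)" for n
      by (intro pred_intros_logic pred_in_fam[OF g id] pred_Union_fam[OF P g])+
    then show "(\<lambda>x. weight w x (fam J x \<inter> \<Union>P)) \<in> borel_measurable M"
      "(\<lambda>x. weight w x (fam J x - \<Union>P)) \<in> borel_measurable M"
      unfolding Int_iff[symmetric] Diff_iff[symmetric]
      by (auto intro!: borel_weight dest: fam_subset_class[THEN subsetD] simp del: Int_iff Diff_iff Union_iff)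
  qed
  have "fam J x \<in> {A \<in> S. pack_over M E w p P A} \<longleftrightarrow>
      fam J x \<in> S \<and> (\<forall>j\<in>set J. \<forall>K. fam K (g j x) \<in> P \<longrightarrow> g j x \<in> fam K (g j x) \<longrightarrow> fam K (g j x) \<subseteq> fam J x) \<and>
      ennreal p * weight w x (fam J x \<inter> \<Union>P) \<le> weight w x (fam J x - \<Union>P)" (is "?L \<longleftrightarrow> ?R")
    if x: "x \<in> space M" for x
  proof (cases "fam J x \<in> S")
    case True
    then have A: "fam J x \<in> finite_class_subsets M E" using SF by blast
    have sub: "B \<subseteq> fam J x \<Longrightarrow> weight w x B = ennreal (\<Sum>y\<in>B. w x y) \<and> 0 \<le> (\<Sum>y\<in>B. w x y)" for B
      using finite_class_subsetsD(1)[OF A] fam_subset_class[OF x, of J]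
      by (auto intro!: weight_finite sum_nonneg w_nonneg intro: finite_subset)
    have "ennreal p * weight w x (fam J x \<inter> \<Union>P) \<le> weight w x (fam J x - \<Union>P) \<longleftrightarrow>
        p * (\<Sum>y\<in>fam J x \<inter> \<Union>P. w x y) \<le> (\<Sum>y\<in>fam J x - \<Union>P. w x y)"
      using p sub[of "fam J x \<inter> \<Union>P"] sub[of "fam J x - \<Union>P"]
      by (simp add: ennreal_mult[symmetric] ennreal_le_iff)
    moreover have "(\<forall>U\<in>P. U \<inter> fam J x \<noteq> {} \<longrightarrow> U \<subseteq> fam J x) \<longleftrightarrow>
      (\<forall>j\<in>set J. \<forall>K. fam K (g j x) \<in> P \<longrightarrow> g j x \<in> fam K (g j x) \<longrightarrow> fam K (g j x) \<subseteq> fam J x)"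
      (is "?l \<longleftrightarrow> ?r")
    proof
      assume ?l
      show ?r
      proof (intro ballI allI impI)
        fix j K assume "j \<in> set J" "fam K (g j x) \<in> P" "g j x \<in> fam K (g j x)"
        then show "fam K (g j x) \<subseteq> fam J x"
          using \<open>?l\<close> by (auto simp: fam_def[of J])
      qed
    next
      assume r: ?r
      show ?l
      proof (intro ballI impI)
        fix U assume U: "U \<in> P" "U \<inter> fam J x \<noteq> {}"
        then obtain j where j: "j \<in> set J" "g j x \<in> U" by (auto simp: fam_def)
        have "finite U" "U \<subseteq> E `` {g j x}" using U(1) j(2) PF finite_class_subsetsD by blast+
        then obtain K where "U = fam K (g j x)" by (rule fam_onto)
        then show "U \<subseteq> fam J x" using r j U(1) by blast
      qed
    qed
    ultimately show ?thesis
      using True pack_over_iff[OF PF p A x fam_subset_class[OF x]] by simp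
  qed auto
  moreover have "Measurable.pred M (\<lambda>x. fam J x \<in> S \<and>
      (\<forall>j\<in>set J. \<forall>K. fam K (g j x) \<in> P \<longrightarrow> g j x \<in> fam K (g j x) \<longrightarrow> fam K (g j x) \<subseteq> fam J x) \<and>
      ennreal p * weight w x (fam J x \<inter> \<Union>P) \<le> weight w x (fam J x - \<Union>P))"
    by measurable
  ultimately show "Measurable.pred M (\<lambda>x. fam J x \<in> {A \<in> S. pack_over M E w p P A})"
    by (subst measurable_cong)
qed

text \<open>The colour of a finite set \<open>A\<close> consists of Borel sets separating its points together with, for each of
  these Borel sets, an index list by which the point in it determines \<open>A\<close>. A point common to two sets
  of the same colour therefore determines both.\<close>

lemma borel_colouring:
  assumes S: "borel_fam S"
  obtains s :: "nat \<Rightarrow> 'a set set" where "\<And>n. borel_fam (s n)" "\<And>n. disjoint (s n)" "\<And>n. s n \<subseteq> S"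
    "\<And>A N. A \<in> S \<Longrightarrow> \<exists>n\<ge>N. A \<in> s n"
proof -
  obtain V :: "nat \<Rightarrow> 'a set" where V [measurable]: "\<And>i. V i \<in> sets M"
    and sep: "\<And>A x. finite A \<Longrightarrow> A \<subseteq> space M \<Longrightarrow> x \<in> A \<Longrightarrow> \<exists>i. V i \<inter> A = {x}"
    by (rule standard_borel_separates_finite[OF standard]) blast
  define col :: "(nat \<times> nat list) list \<Rightarrow> 'a set set" where
    "col c = {A \<in> S. (\<forall>x\<in>A. \<exists>d\<in>set c. x \<in> V (fst d)) \<and>
      (\<forall>d\<in>set c. \<forall>x\<in>A. x \<in> V (fst d) \<longrightarrow> A = fam (snd d) x)}" for c
  have SF: "S \<subseteq> finite_class_subsets M E" using S by (simp add: borel_fam_def)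
  have id: "(\<lambda>x. x) \<in> measurable M M" by simp
  have borel: "borel_fam (col c)" for c
    unfolding borel_fam_def
  proof (intro conjI allI)
    show "col c \<subseteq> finite_class_subsets M E" using SF by (auto simp: col_def)
    fix J
    note [measurable] = borel_famD2[OF S id] pred_fam_eq[OF id g]
    have "Measurable.pred M (\<lambda>x. fam J x \<in> S \<and> (\<forall>j\<in>set J. \<exists>d\<in>set c. g j x \<in> V (fst d)) \<and>
        (\<forall>d\<in>set c. \<forall>j\<in>set J. g j x \<in> V (fst d) \<longrightarrow> fam J x = fam (snd d) (g j x)))"
      by measurable
    also have "(\<lambda>x. fam J x \<in> S \<and> (\<forall>j\<in>set J. \<exists>d\<in>set c. g j x \<in> V (fst d)) \<and>
        (\<forall>d\<in>set c. \<forall>j\<in>set J. g j x \<in> V (fst d) \<longrightarrow> fam J x = fam (snd d) (g j x))) = (\<lambda>x. fam J x \<in> col c)"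
      by (auto simp: col_def fam_def[of J])
    finally show "Measurable.pred M (\<lambda>x. fam J x \<in> col c)" .
  qed
  have disj: "disjoint (col c)" for c
  proof (rule disjointI)
    fix A B assume AB: "A \<in> col c" "B \<in> col c" "A \<noteq> B"
    show "A \<inter> B = {}"
    proof (rule ccontr)
      assume "A \<inter> B \<noteq> {}"
      then obtain x where x: "x \<in> A" "x \<in> B" by blast
      then obtain d where "d \<in> set c" "x \<in> V (fst d)" using AB(1) by (auto simp: col_def)
      then have "A = fam (snd d) x" "B = fam (snd d) x" using AB(1,2) x unfolding col_def by blast+
      then show False using AB(3) by simp
    qed
  qed
  have cover: "\<exists>c. A \<in> col c" if A: "A \<in> S" for A
  proof -
    have AF: "finite A" "A \<subseteq> space M" "\<And>x. x \<in> A \<Longrightarrow> A \<subseteq> E `` {x}"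
      using SF A finite_class_subsetsD by blast+
    have "\<exists>d. V (fst d) \<inter> A = {x} \<and> A = fam (snd d) x" if x: "x \<in> A" for x
    proof -
      obtain i where "V i \<inter> A = {x}" using sep[OF AF(1,2) x] by blast
      moreover obtain J where "A = fam J x" using fam_onto[OF AF(1) AF(3)[OF x]] .
      ultimately show ?thesis by (intro exI[of _ "(i, J)"]) simp
    qed
    then obtain d where d: "\<And>x. x \<in> A \<Longrightarrow> V (fst (d x)) \<inter> A = {x}" "\<And>x. x \<in> A \<Longrightarrow> A = fam (snd (d x)) x"
      by metis
    obtain c where c: "set c = d ` A" using finite_list[of "d ` A"] AF(1) by auto
    have "A \<in> col c"
      unfolding col_def
    proof (intro CollectI conjI ballI impI)
      show "A \<in> S" by fact
      fix x assume "x \<in> A"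
      then show "\<exists>e\<in>set c. x \<in> V (fst e)" using d(1) c by blast
    next
      fix e x assume e: "e \<in> set c" "x \<in> A" "x \<in> V (fst e)"
      then obtain y where y: "y \<in> A" "e = d y" using c by auto
      \<comment> \<open>The separating set belonging to \<open>y\<close> meets \<open>A\<close> in
        \<open>y\<close> alone.\<close>
      then have "x = y" using d(1)[OF y(1)] e(2,3) by blast
      then show "A = fam (snd e) x" using d(2)[OF y(1)] y(2) by simp
    qed
    then show ?thesis ..
  qed
  show ?thesis
  \<comment> \<open>The first component of the decoded index names the colour; the second ranges
    freely, which makes every colour recur beyond each \<open>N\<close>.\<close>
  proof (rule that[of "\<lambda>n. col (from_nat (fst (prod_decode n)))"])
    fix A N assume "A \<in> S"
    then obtain c where c: "A \<in> col c" using cover by blast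
    show "\<exists>n\<ge>N. A \<in> col (from_nat (fst (prod_decode n)))"
      using c le_prod_encode_2[of N "to_nat c"] by (intro exI[of _ "prod_encode (to_nat c, N)"]) simp
  qed (use borel disj in \<open>auto simp: col_def\<close>)
qed

end

section \<open>The sequence of tilings\<close>

locale packing = enumerated_cocycle +
  fixes p :: real and s :: "nat \<Rightarrow> 'a set set"
  assumes p: "0 < p" and borel_s: "borel_fam (s n)" and disjoint_s: "disjoint (s n)"
begin

primrec tiles :: "nat \<Rightarrow> 'a set set" where
  "tiles 0 = {}"
| "tiles (Suc n) = (let Q = {A \<in> s n. pack_over M E w p (tiles n) A} in {U \<in> tiles n. U \<inter> \<Union>Q = {}} \<union> Q)"

definition packs :: "nat \<Rightarrow> 'a set set" where
  "packs n = {A \<in> s n. pack_over M E w p (tiles n) A}"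

lemma tiles_Suc: "tiles (Suc n) = {U \<in> tiles n. U \<inter> \<Union>(packs n) = {}} \<union> packs n"
  by (simp add: packs_def Let_def)

declare tiles.simps(2) [simp del]

lemma borel_tiles: "borel_fam (tiles n)"
proof (induction n)
  case 0
  show ?case by (simp add: borel_fam_def)
next
  case (Suc n)
  have packs: "borel_fam (packs n)"
    unfolding packs_def using Suc borel_s p by (intro borel_fam_packs) auto
  have id: "(\<lambda>x. x) \<in> measurable M M" by simp
  have "Measurable.pred M (\<lambda>x. fam J x \<in> tiles (Suc n))" for J
  proof -
    note [measurable] = borel_famD2[OF Suc id] borel_famD2[OF packs id]
    have [measurable]: "Measurable.pred M (\<lambda>x. \<forall>j\<in>set J. g j x \<notin> \<Union>(packs n))"
      by (intro pred_intros_logic pred_intros_finite pred_Union_fam[OF packs] g finite_set)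
    have "Measurable.pred M (\<lambda>x. fam J x \<in> tiles n \<and> (\<forall>j\<in>set J. g j x \<notin> \<Union>(packs n)) \<or> fam J x \<in> packs n)"
      by measurable
    also have "(\<lambda>x. fam J x \<in> tiles n \<and> (\<forall>j\<in>set J. g j x \<notin> \<Union>(packs n)) \<or> fam J x \<in> packs n) =
        (\<lambda>x. fam J x \<in> tiles (Suc n))"
      by (auto simp: tiles_Suc fam_def[of J])
    finally show ?thesis .
  qed
  then show ?case
    using Suc packs unfolding borel_fam_def tiles_Suc by auto
qed

lemma borel_packs: "borel_fam (packs n)"
  unfolding packs_def using borel_tiles borel_s p by (intro borel_fam_packs) auto

lemma tiles_finite_class: "tiles n \<subseteq> finite_class_subsets M E"
  using borel_tiles by (simp add: borel_fam_def)

lemma packs_finite_class: "packs n \<subseteq> finite_class_subsets M E"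
  using borel_packs by (simp add: borel_fam_def)

lemma disjoint_packs: "disjoint (packs n)"
  using disjoint_s[of n] unfolding packs_def by (rule pairwise_subset) auto

lemma disjoint_tiles: "disjoint (tiles n)"
proof (induction n)
  case (Suc n)
  have "disjoint {U \<in> tiles n. U \<inter> \<Union>(packs n) = {}}" using Suc by (rule pairwise_subset) auto
  then show ?case
    unfolding tiles_Suc using disjoint_packs[of n] by (intro disjoint_union) auto
qed (simp add: disjoint_def)

lemma tiles_subset: "tiles n \<subseteq> (\<Union>m. s m)"
  by (induction n) (auto simp: tiles_Suc packs_def)

lemma pack_class:
  assumes "A \<in> packs n" "x \<in> A"
  shows "finite A" "A \<subseteq> E `` {x}" "x \<in> space M" "A \<in> finite_class_subsets M E"
  using assms packs_finite_class finite_class_subsetsD by blast+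

lemma pack_iff:
  assumes "A \<in> packs n" "x \<in> A"
  shows "(\<forall>U\<in>tiles n. U \<inter> A \<noteq> {} \<longrightarrow> U \<subseteq> A) \<and>
    p * (\<Sum>y\<in>A \<inter> \<Union>(tiles n). w x y) \<le> (\<Sum>y\<in>A - \<Union>(tiles n). w x y)"
  using pack_over_iff[OF tiles_finite_class less_imp_le[OF p] pack_class(4)[OF assms] pack_class(3,2)[OF assms]]
    assms(1) by (simp add: packs_def)

lemma pack_invariant:
  assumes "A \<in> packs n" "U \<in> tiles n" "U \<inter> A \<noteq> {}"
  shows "U \<subseteq> A"
proof -
  obtain x where "x \<in> A" using assms(3) by blast
  then show ?thesis using pack_iff[OF assms(1)] assms(2,3) by blast
qed

text \<open>Coverage is never lost: a tile is discarded only when it meets a new pack, and by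
  invariance that pack contains it.\<close>

lemma Union_tiles: "\<Union>(tiles n) = (\<Union>m<n. \<Union>(packs m))"
proof (induction n)
  case (Suc n)
  have "\<Union>(tiles (Suc n)) = \<Union>(tiles n) \<union> \<Union>(packs n)"
  proof
    show "\<Union>(tiles n) \<union> \<Union>(packs n) \<subseteq> \<Union>(tiles (Suc n))"
    proof
      fix x assume x: "x \<in> \<Union>(tiles n) \<union> \<Union>(packs n)"
      show "x \<in> \<Union>(tiles (Suc n))"
      proof (cases "x \<in> \<Union>(packs n)")
        case False
        then obtain U where U: "U \<in> tiles n" "x \<in> U" using x by blast
        have "U \<inter> \<Union>(packs n) = {}"
        proof (rule ccontr)
          assume "U \<inter> \<Union>(packs n) \<noteq> {}"
          then obtain A where "A \<in> packs n" "U \<inter> A \<noteq> {}" by blast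
          then show False using pack_invariant U False by blast
        qed
        then show ?thesis using U by (auto simp: tiles_Suc)
      qed (auto simp: tiles_Suc)
    qed
  qed (auto simp: tiles_Suc)
  then show ?case using Suc by (simp add: lessThan_Suc Un_commute)
qed simp

text \<open>Tiles only merge, so points that once shared a pack share a tile forever.\<close>

lemma same_tile:
  assumes "A \<in> packs n" "x \<in> A" "y \<in> A" "n < m"
  shows "\<exists>U\<in>tiles m. x \<in> U \<and> y \<in> U"
  using Suc_leI[OF assms(4)]
proof (induction m rule: dec_induct)
  case base
  then show ?case using assms by (auto simp: tiles_Suc)
next
  case (step m)
  then obtain U where U: "U \<in> tiles m" "x \<in> U" "y \<in> U" by auto
  show ?case
  proof (cases "U \<inter> \<Union>(packs m) = {}")
    case False
    then obtain B where B: "B \<in> packs m" "U \<inter> B \<noteq> {}" by blast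
    then show ?thesis using pack_invariant[OF B(1) U(1)] U by (auto simp: tiles_Suc)
  qed (use U in \<open>auto simp: tiles_Suc\<close>)
qed

lemma pack_together:
  assumes "A \<in> packs n" "x \<in> A" "y \<in> A" "n < m" "x \<in> \<Union>(packs m)"
  shows "y \<in> \<Union>(packs m)"
proof -
  obtain U where U: "U \<in> tiles m" "x \<in> U" "y \<in> U" using same_tile[OF assms(1-4)] by blast
  obtain B where "B \<in> packs m" "x \<in> B" using assms(5) by blast
  then show ?thesis using pack_invariant[of B m U] U by blast
qed

section \<open>Unstable points and the limit tiling\<close>

text \<open>Since a pack always contains an uncovered point, as \<open>pack_fresh\<close> shows,
  each further pack through a covered point really changes its tile.\<close>

definition unstable :: "'a set" where
  "unstable = {x \<in> space M. \<forall>N. \<exists>n\<ge>N. x \<in> \<Union>(packs n)}"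

definition limit_tiles :: "'a set set" where
  "limit_tiles = {U. \<exists>N. \<forall>n\<ge>N. U \<in> tiles n}"

text \<open>This makes the fresh points in a pack of an unstable point unstable too, so that all of
  them take part in paying it.\<close>

lemma unstable_together:
  assumes "A \<in> packs n" "x \<in> A" "y \<in> A" "x \<in> unstable"
  shows "y \<in> unstable"
  unfolding unstable_def
proof (intro CollectI conjI allI)
  show "y \<in> space M" using pack_class(3)[OF assms(1,3)] .
  fix N
  obtain m where "m \<ge> max N (Suc n)" "x \<in> \<Union>(packs m)" using assms(4) unfolding unstable_def by blast
  then show "\<exists>n\<ge>N. y \<in> \<Union>(packs n)" using pack_together[OF assms(1-3), of m] by auto
qed

lemma borel_unstable: "unstable \<in> sets M"
proof -
  have id: "(\<lambda>x. x) \<in> measurable M M" by simp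
  have "Measurable.pred M (\<lambda>x. \<forall>N. \<exists>n. N \<le> n \<and> x \<in> \<Union>(packs n))"
    by (intro pred_intros_countable pred_intros_logic pred_Union_fam[OF borel_packs id]) simp
  then show ?thesis unfolding unstable_def pred_def .
qed

text \<open>Saturation is a projection, in general only analytic; the enumeration of the classes
  replaces it by a countable union of Borel preimages.\<close>

lemma borel_saturation_unstable: "E `` unstable \<in> sets M"
proof -
  have "E `` unstable = {x \<in> space M. \<exists>n. g n x \<in> unstable}"
  proof (intro set_eqI iffI)
    fix x assume "x \<in> E `` unstable"
    then obtain y where y: "y \<in> unstable" "(y, x) \<in> E" by blast
    then obtain n where "y = g n x" using class_g[OF E_sym] by blast
    then show "x \<in> {x \<in> space M. \<exists>n. g n x \<in> unstable}" using y E_space by auto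
  qed (use g_in_class E_sym in blast)
  also have "\<dots> \<in> sets M"
    using borel_unstable g by measurable
  finally show ?thesis .
qed

lemma invariant_saturation_unstable: "invariant_under E (E `` unstable)"
  unfolding invariant_under_def
proof
  show "E `` unstable \<subseteq> E `` (E `` unstable)"
    using E_refl E_space by blast
qed (use E_trans in blast)

lemma borel_limit_tiles: "borel_fam limit_tiles"
  unfolding borel_fam_def
proof (intro conjI allI)
  show "limit_tiles \<subseteq> finite_class_subsets M E"
    using tiles_finite_class by (auto simp: limit_tiles_def)
  fix J
  have "Measurable.pred M (\<lambda>x. fam J x \<in> tiles n)" for n
    using borel_tiles by (simp add: borel_fam_def)
  then have "Measurable.pred M (\<lambda>x. \<exists>N. \<forall>n. N \<le> n \<longrightarrow> fam J x \<in> tiles n)"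
    by (intro pred_intros_countable pred_intros_logic) simp
  then show "Measurable.pred M (\<lambda>x. fam J x \<in> limit_tiles)" unfolding limit_tiles_def mem_Collect_eq .
qed

lemma disjoint_limit_tiles: "disjoint limit_tiles"
proof (rule disjointI)
  fix A B assume "A \<in> limit_tiles" "B \<in> limit_tiles" "A \<noteq> B"
  then obtain m n where "\<forall>k\<ge>m. A \<in> tiles k" "\<forall>k\<ge>n. B \<in> tiles k" by (auto simp: limit_tiles_def)
  then have "A \<in> tiles (max m n)" "B \<in> tiles (max m n)" by auto
  then show "A \<inter> B = {}" using disjoint_tiles \<open>A \<noteq> B\<close> by (auto simp: disjoint_def)
qed

lemma limit_tiles_subset: "limit_tiles \<subseteq> (\<Union>m. s m)"
  using tiles_subset by (auto simp: limit_tiles_def)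

text \<open>A finite set of stable points is met by no pack from some stage on, and from then on the
  tiles meeting it are those of the limit. If it were a pack over the limit tiling, it would become
  a tile when its colour next recurs, a contradiction.\<close>

lemma packed_off_unstable:
  assumes recur: "\<And>A N. A \<in> S \<Longrightarrow> \<exists>n\<ge>N. A \<in> s n"
  shows "packed_within M E w p (family_restrict limit_tiles (space M - E `` unstable))
    (family_restrict S (space M - E `` unstable))"
  unfolding packed_within_def
proof (intro ballI notI)
  define P where "P = family_restrict limit_tiles (space M - E `` unstable)"
  fix A assume "A \<in> family_restrict S (space M - E `` unstable)"
    and "pack_over M E w p (family_restrict limit_tiles (space M - E `` unstable)) A"
  then have AS: "A \<in> S" and AD: "A \<inter> E `` unstable = {}" and pack: "pack_over M E w p P A"
    by (auto simp: family_restrict_def P_def)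
  have AF: "A \<in> finite_class_subsets M E" using pack by (simp add: pack_over_def)
  then obtain x where x: "x \<in> A" using finite_class_subsetsD by blast
  note A = finite_class_subsetsD[OF AF]
  have PF: "P \<subseteq> finite_class_subsets M E"
    using borel_limit_tiles by (auto simp: P_def family_restrict_def borel_fam_def)
  have "\<exists>N. \<forall>n\<ge>N. y \<notin> \<Union>(packs n)" if "y \<in> A" for y
  proof -
    have "y \<notin> unstable" using AD E_refl A(3) that by blast
    then show ?thesis using A(3) that unfolding unstable_def by blast
  qed
  then obtain N where N: "\<And>y n. y \<in> A \<Longrightarrow> n \<ge> N y \<Longrightarrow> y \<notin> \<Union>(packs n)" by metis
  define N0 where "N0 = Max (N ` A)"
  have N0: "y \<notin> \<Union>(packs n)" if "y \<in> A" "n \<ge> N0" for y n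
  proof -
    have "N y \<le> N0" unfolding N0_def using A(1) that(1) by simp
    then show ?thesis using N[OF that(1), of n] that(2) by simp
  qed
  obtain n where n: "n \<ge> N0" "A \<in> s n" using recur[OF AS] by blast
  have same: "U \<in> tiles n \<longleftrightarrow> U \<in> P" if "y \<in> U" "y \<in> A" for U y
  proof
    assume U: "U \<in> tiles n"
    have "U \<in> tiles m" if "m \<ge> n" for m
      using that
    proof (induction m rule: dec_induct)
      case (step m)
      have "U \<inter> \<Union>(packs m) = {}"
      proof (rule ccontr)
        assume "U \<inter> \<Union>(packs m) \<noteq> {}"
        then obtain B where "B \<in> packs m" "U \<inter> B \<noteq> {}" by blast
        then show False using pack_invariant[of B m U] step N0[OF \<open>y \<in> A\<close>, of m] n(1) \<open>y \<in> U\<close> by auto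
      qed
      then show ?case using step by (simp add: tiles_Suc)
    qed (rule U)
    then have "U \<in> limit_tiles" by (auto simp: limit_tiles_def)
    \<comment> \<open>A tile lies in one class and the removed set is saturated, so one point
      outside that set suffices.\<close>
    moreover have "U \<subseteq> space M - E `` unstable"
    proof
      fix z assume "z \<in> U"
      have UF: "U \<in> finite_class_subsets M E" using U tiles_finite_class by blast
      have yz: "(y, z) \<in> E" using finite_class_subsetsD(4)[OF UF \<open>y \<in> U\<close>] \<open>z \<in> U\<close> by blast
      moreover have "y \<notin> E `` unstable" using AD \<open>y \<in> A\<close> by blast
      ultimately show "z \<in> space M - E `` unstable"
        using E_space(2)[OF yz] E_trans[OF _ E_sym[OF yz]] by auto
    qed
    ultimately show "U \<in> P" by (simp add: P_def family_restrict_def)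
  next
    assume "U \<in> P"
    then obtain k where k: "\<forall>m\<ge>k. U \<in> tiles m" by (auto simp: P_def family_restrict_def limit_tiles_def)
    \<comment> \<open>Going back from a late stage to \<open>n\<close>: a tile containing
      \<open>y\<close> cannot have been created in between, as no pack then contains
      \<open>y\<close>.\<close>
    have "n \<le> max k n" by simp
    then show "U \<in> tiles n"
    proof (induction rule: inc_induct)
      case base
      show ?case using k by simp
    next
      case (step m)
      then have "m \<ge> N0" using n(1) by simp
      then have "U \<notin> packs m" using N0[OF \<open>y \<in> A\<close>, of m] \<open>y \<in> U\<close> by blast
      then show ?case using step by (auto simp: tiles_Suc)
    qed
  qed
  have Un: "A \<inter> \<Union>(tiles n) = A \<inter> \<Union>P" "A - \<Union>(tiles n) = A - \<Union>P" using same by blast+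
  have "pack_over M E w p (tiles n) A"
    using pack same unfolding pack_over_iff[OF tiles_finite_class less_imp_le[OF p] AF A(3)[THEN subsetD, OF x] A(4)[OF x]]
      pack_over_iff[OF PF less_imp_le[OF p] AF A(3)[THEN subsetD, OF x] A(4)[OF x]] Un by blast
  then have "A \<in> packs n" using n(2) by (simp add: packs_def)
  then show False using N0[OF x n(1)] x by blast
qed

section \<open>Transport towards the unstable points\<close>

definition first_cover :: "'a \<Rightarrow> nat" where
  "first_cover x = (LEAST n. x \<in> \<Union>(packs n))"

text \<open>Only stages strictly before \<open>n\<close> count, so the value 0 characterises the
  fresh points. A sum of indicators makes measurability immediate.\<close>

definition cover_count :: "nat \<Rightarrow> 'a \<Rightarrow> nat" where
  "cover_count n x = (\<Sum>m<n. if x \<in> \<Union>(packs m) then 1 else 0)"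

text \<open>By disjointness the union has at most one member; it is empty when no pack contains
  \<open>x\<close>.\<close>

definition pack_of :: "nat \<Rightarrow> 'a \<Rightarrow> 'a set" where
  "pack_of n x = \<Union>{A \<in> packs n. x \<in> A}"

text \<open>The detour through \<open>weight\<close> gives measurability from
  \<open>borel_weight\<close>; the set is finite, so the conversion to a real loses nothing.\<close>

definition fresh_mass :: "nat \<Rightarrow> 'a \<Rightarrow> real" where
  "fresh_mass n x = enn2real (weight w x (pack_of n x - \<Union>(tiles n)))"

definition rounds :: nat where
  "rounds = nat \<lceil>1 / p\<rceil>"

text \<open>An unstable point spends its mass when it is first covered, on the older points of its pack. A point
  receives \<open>1 / rounds\<close> at each of the first \<open>rounds\<close> times at which it is covered anew. The pack
  inequality makes this affordable because \<open>1 \<le> p * rounds\<close>.\<close>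

definition refund :: "'a \<Rightarrow> 'a \<Rightarrow> real" where
  "refund y x = (if y \<in> unstable \<and> x \<in> unstable \<and> x \<in> pack_of (first_cover y) y \<and>
      1 \<le> cover_count (first_cover y) x \<and> cover_count (first_cover y) x \<le> rounds
    then w y x / (rounds * fresh_mass (first_cover y) y) else 0)"

lemma rounds: "1 \<le> rounds" "1 \<le> p * rounds"
proof -
  have "1 / p \<le> of_int \<lceil>1 / p\<rceil>" by (rule le_of_int_ceiling)
  moreover have "0 < \<lceil>1 / p\<rceil>" using p by simp
  ultimately have "1 / p \<le> real rounds" "0 < rounds" by (simp_all add: rounds_def)
  then show "1 \<le> rounds" "1 \<le> p * rounds" using p by (simp_all add: field_simps)
qed

lemma pack_of_eq:
  assumes "A \<in> packs n" "x \<in> A"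
  shows "pack_of n x = A"
proof -
  have "{B \<in> packs n. x \<in> B} = {A}"
    using assms disjoint_packs[of n] by (auto simp: disjoint_def)
  then show ?thesis by (simp add: pack_of_def)
qed

lemma pack_ofD:
  assumes "y \<in> pack_of n x"
  obtains A where "A \<in> packs n" "x \<in> A" "y \<in> A" "pack_of n x = A"
  using assms pack_of_eq unfolding pack_of_def by blast

lemma cover_count_card: "cover_count n x = card ({m. x \<in> \<Union>(packs m)} \<inter> {..<n})"
  by (simp add: cover_count_def sum.If_cases Int_commute)

lemma cover_count_pos: "1 \<le> cover_count n x \<longleftrightarrow> x \<in> \<Union>(tiles n)"
proof -
  have "1 \<le> cover_count n x \<longleftrightarrow> {m. x \<in> \<Union>(packs m)} \<inter> {..<n} \<noteq> {}"
    unfolding cover_count_card by (metis Suc_le_eq One_nat_def card_gt_0_iff finite_Int finite_lessThan)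
  then show ?thesis unfolding Union_tiles by blast
qed

lemma first_cover:
  assumes "x \<in> unstable"
  shows "x \<in> \<Union>(packs (first_cover x))" "x \<notin> \<Union>(tiles (first_cover x))"
proof -
  have "\<exists>n. x \<in> \<Union>(packs n)" using assms unfolding unstable_def by blast
  then show "x \<in> \<Union>(packs (first_cover x))" unfolding first_cover_def by (rule LeastI_ex)
  show "x \<notin> \<Union>(tiles (first_cover x))"
    unfolding Union_tiles first_cover_def using not_less_Least by blast
qed

lemma first_cover_eq:
  assumes "x \<in> \<Union>(packs n)" "x \<notin> \<Union>(tiles n)"
  shows "first_cover x = n"
  unfolding first_cover_def
proof (rule Least_equality)
  fix m assume "x \<in> \<Union>(packs m)"
  then show "n \<le> m" using assms(2) unfolding Union_tiles by (meson UN_I lessThan_iff linorder_not_le)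
qed (fact assms(1))

lemma fresh_mass_eq:
  assumes "A \<in> packs n" "x \<in> A"
  shows "fresh_mass n x = (\<Sum>z\<in>A - \<Union>(tiles n). w x z)"
proof -
  have "weight w x (A - \<Union>(tiles n)) = ennreal (\<Sum>z\<in>A - \<Union>(tiles n). w x z)"
    using pack_class[OF assms] by (intro weight_finite) auto
  moreover have "0 \<le> (\<Sum>z\<in>A - \<Union>(tiles n). w x z)"
    using pack_class(2)[OF assms] by (intro sum_nonneg w_nonneg) auto
  ultimately show ?thesis by (simp add: fresh_mass_def pack_of_eq[OF assms])
qed

text \<open>Without fresh points the pack inequality would bound the positive number p times the
  weight of \<open>A\<close> by 0.\<close>

lemma pack_fresh:
  assumes "A \<in> packs n"
  shows "A - \<Union>(tiles n) \<noteq> {}"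
proof
  assume *: "A - \<Union>(tiles n) = {}"
  obtain x where x: "x \<in> A" using packs_finite_class assms finite_class_subsetsD(2) by blast
  have "0 < (\<Sum>y\<in>A. w x y)"
    using pack_class[OF assms x] x w_pos by (intro sum_pos) auto
  moreover have "A \<inter> \<Union>(tiles n) = A" using * by blast
  ultimately have "0 < p * (\<Sum>y\<in>A \<inter> \<Union>(tiles n). w x y)" using p by simp
  then show False using pack_iff[OF assms x] * by simp
qed

lemma fresh_mass_pos:
  assumes "A \<in> packs n" "x \<in> A"
  shows "0 < fresh_mass n x"
  unfolding fresh_mass_eq[OF assms]
  using pack_class[OF assms] pack_fresh[OF assms(1)] w_pos by (intro sum_pos) auto

lemma refund_nonneg: "(y, x) \<in> E \<Longrightarrow> 0 \<le> refund y x"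
  by (simp add: refund_def w_nonneg fresh_mass_def)

text \<open>The stage \<open>first_cover\<close> varies with the point but takes countably many
  values, so measurability is checked with the stage frozen at each \<open>n\<close>.\<close>

lemma borel_refund: "borel_on_rel M E refund"
proof (rule borel_on_relI)
  fix i
  have id: "(\<lambda>x. x) \<in> measurable M M" by simp
  note [measurable] = borel_unstable borel_w
  have cover: "Measurable.pred M (\<lambda>x. h x \<in> \<Union>(packs n))" if "h \<in> measurable M M" for h n
    by (rule pred_Union_fam[OF borel_packs that])
  have count: "(\<lambda>x. cover_count n (g i x)) \<in> measurable M (count_space UNIV)" for n
    unfolding cover_count_def using cover[OF g] by measurable
  have in_pack: "Measurable.pred M (\<lambda>x. g j x \<in> pack_of n x)" for j n
  proof -
    note [measurable] = borel_famD2[OF borel_packs id] pred_in_fam[OF g id] pred_in_fam[OF id id]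
    have "Measurable.pred M (\<lambda>x. \<exists>J. fam J x \<in> packs n \<and> x \<in> fam J x \<and> g j x \<in> fam J x)"
      by measurable
    also have "(\<lambda>x. \<exists>J. fam J x \<in> packs n \<and> x \<in> fam J x \<and> g j x \<in> fam J x) = (\<lambda>x. g j x \<in> pack_of n x)"
    proof (intro ext iffI)
      fix x assume "g j x \<in> pack_of n x"
      then obtain A where A: "A \<in> packs n" "x \<in> A" "g j x \<in> A" by (rule pack_ofD)
      obtain J where "A = fam J x" using fam_onto[OF pack_class(1,2)[OF A(1,2)]] .
      then show "\<exists>J. fam J x \<in> packs n \<and> x \<in> fam J x \<and> g j x \<in> fam J x" using A by blast
    qed (auto simp: pack_of_def)
    finally show ?thesis .
  qed
  have mass: "(\<lambda>x. fresh_mass n x) \<in> borel_measurable M" for n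
  proof -
    have "Measurable.pred M (\<lambda>x. g j x \<in> pack_of n x - \<Union>(tiles n))" for j
      unfolding Diff_iff by (intro pred_intros_logic in_pack pred_Union_fam[OF borel_tiles g])
    moreover have "pack_of n x - \<Union>(tiles n) \<subseteq> E `` {x}" for x
      using pack_class(2) unfolding pack_of_def by blast
    ultimately have "(\<lambda>x. weight w x (pack_of n x - \<Union>(tiles n))) \<in> borel_measurable M"
      by (intro borel_weight)
    then show ?thesis unfolding fresh_mass_def by measurable
  qed
  have "first_cover \<in> measurable M (count_space UNIV)"
    unfolding first_cover_def using cover[OF id] by measurable
  moreover have "(\<lambda>x. if x \<in> unstable \<and> g i x \<in> unstable \<and> g i x \<in> pack_of n x \<and>
      1 \<le> cover_count n (g i x) \<and> cover_count n (g i x) \<le> rounds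
    then w x (g i x) / (rounds * fresh_mass n x) else 0) \<in> borel_measurable M" for n
  proof -
    note [measurable] = count in_pack mass
    show ?thesis by measurable
  qed
  ultimately show "(\<lambda>x. refund x (g i x)) \<in> borel_measurable M"
    unfolding refund_def by (rule measurable_compose_countable[rotated])
qed

lemma outflow_stable: "x \<notin> unstable \<Longrightarrow> outflow E refund x = 0"
  by (simp add: outflow_def refund_def)

lemma inflow_stable: "x \<notin> unstable \<Longrightarrow> inflow E w refund x = 0"
  by (simp add: inflow_def refund_def)

text \<open>A point pays only in the pack of its first cover. The recipients there weigh at most as
  much as all old points, hence at most p * rounds times that, hence at most \<open>rounds\<close>
  times the fresh mass by the pack inequality; this is the denominator of the payments.\<close>

lemma outflow_le_1: "outflow E refund y \<le> 1"
proof (cases "y \<in> unstable")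
  case True
  define n where "n = first_cover y"
  obtain A where A: "A \<in> packs n" "y \<in> A" using first_cover(1)[OF True] by (auto simp: n_def)
  note cl = pack_class[OF A]
  define B where "B = {x \<in> A \<inter> \<Union>(tiles n). x \<in> unstable \<and> cover_count n x \<le> rounds}"
  have mass: "0 < fresh_mass n y" by (rule fresh_mass_pos[OF A])
  have r: "refund y x = (if x \<in> B then w y x / (rounds * fresh_mass n y) else 0)" for x
    using True by (auto simp: refund_def n_def[symmetric] pack_of_eq[OF A] B_def cover_count_pos simp del: Union_iff One_nat_def)
  have "outflow E refund y = (\<Sum>x\<in>B. ennreal (refund y x))"
    unfolding outflow_def using cl by (intro infsum_finite_support) (auto simp: B_def r)
  also have "\<dots> = ennreal (\<Sum>x\<in>B. refund y x)"
    using cl by (intro sum_ennreal refund_nonneg) (auto simp: B_def)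
  finally have out: "outflow E refund y = ennreal (\<Sum>x\<in>B. refund y x)" .
  have "(\<Sum>x\<in>B. refund y x) = (\<Sum>x\<in>B. w y x) / (rounds * fresh_mass n y)"
    by (simp add: r sum_divide_distrib)
  also have "\<dots> \<le> 1"
  proof -
    have le: "(\<Sum>x\<in>B. w y x) \<le> (\<Sum>x\<in>A \<inter> \<Union>(tiles n). w y x)"
      using cl w_nonneg by (intro sum_mono2) (auto simp: B_def)
    have nn: "0 \<le> (\<Sum>x\<in>A \<inter> \<Union>(tiles n). w y x)"
      using cl w_nonneg by (intro sum_nonneg) auto
    then have "(\<Sum>x\<in>A \<inter> \<Union>(tiles n). w y x) \<le> (p * rounds) * (\<Sum>x\<in>A \<inter> \<Union>(tiles n). w y x)"
      using mult_right_mono[OF rounds(2) nn] by simp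
    also have "\<dots> = rounds * (p * (\<Sum>x\<in>A \<inter> \<Union>(tiles n). w y x))" by simp
    also have "\<dots> \<le> rounds * fresh_mass n y"
      using pack_iff[OF A] unfolding fresh_mass_eq[OF A] by (intro mult_left_mono) auto
    finally show ?thesis using le mass rounds(1) by simp
  qed
  finally show ?thesis by (simp add: out)
qed (simp add: outflow_stable)

text \<open>In each of the \<open>rounds\<close> packs that cover \<open>x\<close> next after its
  first, the fresh points jointly contribute 1 / rounds.\<close>

lemma inflow_unstable:
  assumes x: "x \<in> unstable"
  shows "inflow E w refund x = 1"
proof -
  define H where "H = {n. x \<in> \<Union>(packs n)}"
  \<comment> \<open>The lower bound 1 excludes the first cover of \<open>x\<close>; infinitely many
    covers guarantee that all \<open>rounds\<close> paying stages exist.\<close>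
  define Z where "Z = {n \<in> H. 1 \<le> cover_count n x \<and> cover_count n x \<le> rounds}"
  have "infinite H"
    using x unfolding infinite_nat_iff_unbounded_le H_def unstable_def by blast
  then have Z: "finite Z" "card Z = rounds"
    using infinite_nat_initial_ranks[of H rounds]
    unfolding Z_def cover_count_card H_def[symmetric] by simp_all
  define B where "B n = pack_of n x - \<Union>(tiles n)" for n
  have pk: "pack_of n x \<in> packs n" "x \<in> pack_of n x" if n: "n \<in> Z" for n
  proof -
    obtain A where A: "A \<in> packs n" "x \<in> A" using n unfolding Z_def H_def by blast
    then show "pack_of n x \<in> packs n" "x \<in> pack_of n x" by (simp_all add: pack_of_eq[OF A])
  qed
  have finB: "finite (B n)" and BE: "B n \<subseteq> E `` {x}" if "n \<in> Z" for n
    using pack_class(1,2)[OF pk[OF that]] unfolding B_def by auto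
  have send: "y \<in> unstable \<and> first_cover y = n \<and>
      refund y x * w x y = w x y / (rounds * (\<Sum>z\<in>B n. w x z))" if n: "n \<in> Z" and y: "y \<in> B n" for n y
  proof -
    define A where "A = pack_of n x"
    have A: "A \<in> packs n" "x \<in> A" "B n = A - \<Union>(tiles n)" using pk[OF n] by (simp_all add: A_def B_def)
    have yA: "y \<in> A" "y \<notin> \<Union>(tiles n)" using y A(3) by auto
    have yu: "y \<in> unstable" by (rule unstable_together[OF A(1,2) yA(1) x])
    have fc: "first_cover y = n" using A(1) yA by (intro first_cover_eq) blast+
    have yx: "(y, x) \<in> E" using pack_class(2)[OF A(1) yA(1)] A(2) by blast
    \<comment> \<open>Rebasing at \<open>x\<close> cancels \<open>w y x\<close> in the payment:
      every fresh point of the pack sends \<open>x\<close> the same amount, and weighting by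
      \<open>w x y\<close> gives shares proportional to their weights.\<close>
    have "fresh_mass n y = w y x * (\<Sum>z\<in>B n. w x z)"
      unfolding fresh_mass_eq[OF A(1) yA(1)] A(3)[symmetric]
      by (rule sum_w_rebase[OF yx BE[OF n]])
    moreover have "refund y x = w y x / (rounds * fresh_mass n y)"
      using yu x n A(2) unfolding refund_def fc pack_of_eq[OF A(1) yA(1)] by (simp add: Z_def)
    ultimately show ?thesis using yu fc w_pos[OF yx] by simp
  qed
  have "inflow E w refund x = (\<Sum>y\<in>(\<Union>n\<in>Z. B n). ennreal (refund y x * w x y))"
    unfolding inflow_def
  proof (rule infsum_finite_support)
    show "finite (\<Union>n\<in>Z. B n)" using Z(1) finB by blast
    show "(\<Union>n\<in>Z. B n) \<subseteq> E `` {x}" using BE by blast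
    fix y assume y: "y \<in> E `` {x} - (\<Union>n\<in>Z. B n)"
    have "refund y x = 0"
    proof (rule ccontr)
      assume "refund y x \<noteq> 0"
      then have r: "y \<in> unstable" "x \<in> pack_of (first_cover y) y" "1 \<le> cover_count (first_cover y) x"
        "cover_count (first_cover y) x \<le> rounds" by (simp_all add: refund_def split: if_splits)
      obtain A where A: "A \<in> packs (first_cover y)" "y \<in> A" "x \<in> A" using r(2) by (rule pack_ofD)
      have "first_cover y \<in> Z" using A r(3,4) by (auto simp: Z_def H_def)
      moreover have "y \<in> B (first_cover y)"
        using first_cover(2)[OF r(1)] A(2) by (simp add: B_def pack_of_eq[OF A(1,3)])
      ultimately show False using y by blast
    qed
    then show "ennreal (refund y x * w x y) = 0" by simp
  qed
  also have "\<dots> = ennreal (\<Sum>y\<in>(\<Union>n\<in>Z. B n). refund y x * w x y)"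
    using BE refund_nonneg[OF E_sym] w_nonneg by (intro sum_ennreal mult_nonneg_nonneg) blast+
  also have "(\<Sum>y\<in>(\<Union>n\<in>Z. B n). refund y x * w x y) = (\<Sum>n\<in>Z. \<Sum>y\<in>B n. refund y x * w x y)"
  proof (rule sum.UNION_disjoint)
    \<comment> \<open>A fresh point in the pack of stage \<open>n\<close> has first cover
      \<open>n\<close>, so it cannot be fresh at two stages.\<close>
    show "\<forall>i\<in>Z. \<forall>j\<in>Z. i \<noteq> j \<longrightarrow> B i \<inter> B j = {}" using send by blast
  qed (use Z finB in auto)
  also have "\<dots> = (\<Sum>n\<in>Z. 1 / rounds)"
  proof (rule sum.cong[OF refl])
    fix n assume n: "n \<in> Z"
    have pos: "0 < (\<Sum>z\<in>B n. w x z)"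
      using fresh_mass_pos[OF pk[OF n]] unfolding fresh_mass_eq[OF pk[OF n]] B_def .
    have "(\<Sum>y\<in>B n. refund y x * w x y) = (\<Sum>y\<in>B n. w x y / (rounds * (\<Sum>z\<in>B n. w x z)))"
      using send[OF n] by (intro sum.cong) auto
    also have "\<dots> = 1 / rounds"
      using pos by (simp add: sum_divide_distrib[symmetric])
    finally show "(\<Sum>y\<in>B n. refund y x * w x y) = 1 / rounds" .
  qed
  also have "\<dots> = 1" using Z rounds(1) by simp
  finally show ?thesis by simp
qed

text \<open>Among the unstable points of the class take one with the earliest first cover. Any
  recipient of its payment would be an unstable point covered still earlier, so it sends nothing
  while receiving 1.\<close>

lemma refund_disbalances:
  assumes C: "C \<in> space M // E" "C \<subseteq> E `` (E `` unstable)"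
  shows "disbalances E w refund C"
proof -
  obtain z where z: "z \<in> space M" "C = E `` {z}" using C(1) by (auto elim: quotientE)
  then have "z \<in> E `` (E `` unstable)" using C(2) E_refl by blast
  then obtain u where "u \<in> unstable" "u \<in> C" using z(2) E_sym E_trans by blast
  then obtain y where y: "y \<in> unstable \<inter> C"
    and min: "\<And>x. x \<in> unstable \<inter> C \<Longrightarrow> first_cover y \<le> first_cover x"
    using ex_has_least_nat[of "\<lambda>x. x \<in> unstable \<inter> C" u first_cover] by blast
  have "refund y x = 0" if "x \<in> E `` {y}" for x
  proof (rule ccontr)
    assume "refund y x \<noteq> 0"
    then have r: "x \<in> unstable" "1 \<le> cover_count (first_cover y) x"
      by (simp_all add: refund_def split: if_splits)
    then obtain m where m: "m < first_cover y" "x \<in> \<Union>(packs m)"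
      unfolding cover_count_pos Union_tiles by blast
    have "first_cover x \<le> m" unfolding first_cover_def using m(2) by (rule Least_le)
    moreover have "x \<in> C" using that y z(2) E_trans by blast
    ultimately show False using min[of x] r(1) m(1) by simp
  qed
  then have "outflow E refund y = 0" unfolding outflow_def by (intro infsum_0) simp
  then have "sink E w refund y" using y inflow_unstable by (simp add: sink_def)
  \<comment> \<open>Inflow is 1 at unstable points, where outflow is at most 1; at stable points
    both vanish.\<close>
  moreover have "\<not> source E w refund x" for x
    using outflow_le_1[of x] outflow_stable[of x] inflow_unstable[of x]
    by (cases "x \<in> unstable") (auto simp: source_def)
  ultimately show ?thesis using y unfolding disbalances_def by blast
qed

lemma deficient_saturation_unstable: "deficient M E w (E `` unstable)"
  unfolding deficient_def
proof (intro conjI exI ballI impI)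
  show "E `` unstable \<subseteq> space M" using E_space by blast
  show "borel_transport M E refund"
    using borel_refund refund_nonneg by (auto simp: borel_transport_def)
  have "inflow E w refund x \<le> 1" for x
    using inflow_unstable[of x] inflow_stable[of x] by (cases "x \<in> unstable") auto
  then show "bounded_transport M E w refund"
    using outflow_le_1 by (simp add: bounded_transport_def)
qed (rule refund_disbalances)

end

theorem theorem7p6:
  fixes M :: "'a measure" and E :: "('a \<times> 'a) set" and w :: "'a \<Rightarrow> 'a \<Rightarrow> real"
    and p :: real and S :: "'a set set"
  assumes "standard_borel M"
    and "countable_borel_equiv M E"
    and "borel_cocycle M E w"
    and "0 < p"
    and "S \<in> sets (finite_class_space M E)"
  shows "\<exists>P D. tiling P \<and> P \<in> sets (finite_class_space M E) \<and> P \<subseteq> S \<and>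
           D \<in> sets M \<and> invariant_under E D \<and> deficient M E w D \<and>
           packed_within M E w p (family_restrict P (space M - D)) (family_restrict S (space M - D))"
proof -
  obtain g :: "nat \<Rightarrow> 'a \<Rightarrow> 'a" where g: "\<And>n. g n \<in> measurable M M"
    "\<And>x. x \<in> space M \<Longrightarrow> E `` {x} = range (\<lambda>n. g n x)"
    using Lusin_Novikov_enumeration[OF assms(1,2)] by blast
  interpret enumerated_cocycle M E w g
    by unfold_locales (fact assms(1-3) g)+
  have S: "borel_fam S"
    using assms(5) by (simp add: borel_fam_iff sets_finite_class_space[OF assms(2)])
  obtain s :: "nat \<Rightarrow> 'a set set" where s: "\<And>n. borel_fam (s n)" "\<And>n. disjoint (s n)" "\<And>n. s n \<subseteq> S"
    and recur: "\<And>A N. A \<in> S \<Longrightarrow> \<exists>n\<ge>N. A \<in> s n"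
    by (rule borel_colouring[OF S]) blast
  interpret packing M E w g p s
    by unfold_locales (fact assms(4) s(1,2))+
  show ?thesis
  proof (intro exI conjI)
    show "tiling limit_tiles" by (simp add: tiling_def disjoint_limit_tiles)
    show "limit_tiles \<in> sets (finite_class_space M E)"
      using borel_limit_tiles by (simp add: borel_fam_iff sets_finite_class_space[OF assms(2)])
    show "limit_tiles \<subseteq> S" using limit_tiles_subset s(3) by blast
    show "E `` unstable \<in> sets M" by (rule borel_saturation_unstable)
    show "invariant_under E (E `` unstable)" by (rule invariant_saturation_unstable)
    show "deficient M E w (E `` unstable)" by (rule deficient_saturation_unstable)
    show "packed_within M E w p (family_restrict limit_tiles (space M - E `` unstable))
        (family_restrict S (space M - E `` unstable))"
      by (rule packed_off_unstable[OF recur])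
  qed
qed

end
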